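(* Let $n\in\mathbb{N}$ and let $(A,b)\in M_n(\mathbb{R})\times\mathbb{R}^n$ be a controllable pair. Assume that every eigenvalue of $A$ has non-positive real part. Then, for every $T,\mu$ with $T\geq\mu>0$, there exists a $(T,\mu)$-stabilizer for the PE system $\dot x=Ax+\alpha u b$, $\alpha\in\mathcal{G}(T,\mu)$.
   Context: For $0<\mu\leq T$, $\mathcal{G}(T,\mu)$ denotes the set of all measurable functions $\alpha:[0,\infty)\to[0,1]$ such that $\int_t^{t+T}\alpha(s)\,ds\geq\mu$ for every $t\geq 0$ (called $(T,\mu)$-signals). The PE system associated to $T,\mu,A,b$ is the family of single-input linear control systems $\dot x=Ax+\alpha(t)ub$, $u\in\mathbb{R}$, $\alpha\in\mathcal{G}(T,\mu)$. A vector $K\in\mathbb{R}^n$ is a $(T,\mu)$-stabilizer for this system if there exist constants $C,\gamma>0$ such that, for every $\alpha\in\mathcal{G}(T,\mu)$, every $t_0\geq 0$ and every $x_0\in\mathbb{R}^n$, the solution $x(\cdot)$ of $\dot x=(A-\alpha(t)bK^T)x$, $x(t_0)=x_0$, satisfies $\|x(t)\|\leq Ce^{-\gamma(t-t_0)}\|x_0\|$ for all $t\geq t_0$. *)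

theory Defs
  imports "HOL-Analysis.Analysis"
begin

text \<open>
  Kalman rank condition: the controllability matrix whose columns are
  \<open>b, A b, ..., A\<^sup>n\<^sup>-\<^sup>1 b\<close> has rank \<open>n\<close>. The iterates are written with \<open>^^\<close> because
  \<open>A ^ k\<close> on \<^typ>\<open>real^'n^'n\<close> is the entrywise power.
\<close>
definition controllable_pair :: "real^'n^'n \<Rightarrow> real^'n \<Rightarrow> bool" where
  "controllable_pair A b \<longleftrightarrow>
     dim {(((*v) A) ^^ k) b | k. k < CARD('n)} = CARD('n)"

definition complex_eigenvalue :: "real^'n^'n \<Rightarrow> complex \<Rightarrow> bool" where
  "complex_eigenvalue A z \<longleftrightarrow>
     (\<exists>v::complex^'n. v \<noteq> 0 \<and> map_matrix complex_of_real A *v v = z *s v)"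

text \<open>
  Signals are total functions of which only the values on \<open>[0, \<infinity>)\<close> matter;
  measurability is Lebesgue measurability.
\<close>
definition PE_signals :: "real \<Rightarrow> real \<Rightarrow> (real \<Rightarrow> real) set" where
  "PE_signals T \<mu> =
     {\<alpha>. \<alpha> \<in> borel_measurable (lebesgue_on {0..}) \<and>
          (\<forall>s\<ge>0. 0 \<le> \<alpha> s \<and> \<alpha> s \<le> 1) \<and>
          (\<forall>t\<ge>0. (LINT s:{t..t+T}|lebesgue. \<alpha> s) \<ge> \<mu>)}"

definition outer_product :: "real^'n \<Rightarrow> real^'n \<Rightarrow> real^'n^'n" where
  "outer_product b K = (\<chi> i j. b $ i * K $ j)"

text \<open>
  Since \<open>\<alpha>\<close> is only measurable, solutions are understood in the sense of Caratheodory
  (absolutely continuous, equation satisfied almost everywhere), expressed by the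
  equivalent integral equation.
\<close>
definition closed_loop_solution ::
  "real^'n^'n \<Rightarrow> real^'n \<Rightarrow> real^'n \<Rightarrow> (real \<Rightarrow> real) \<Rightarrow> real \<Rightarrow> real^'n \<Rightarrow> (real \<Rightarrow> real^'n) \<Rightarrow> bool" where
  "closed_loop_solution A b K \<alpha> t0 x0 x \<longleftrightarrow>
     continuous_on {t0..} x \<and> x t0 = x0 \<and>
     (\<forall>t\<ge>t0. ((\<lambda>s. (A - \<alpha> s *\<^sub>R outer_product b K) *v x s) has_integral (x t - x0)) {t0..t})"

definition stabilizer ::
  "real \<Rightarrow> real \<Rightarrow> real^'n^'n \<Rightarrow> real^'n \<Rightarrow> real^'n \<Rightarrow> bool" where
  "stabilizer T \<mu> A b K \<longleftrightarrow>
     (\<exists>C \<gamma>. C > 0 \<and> \<gamma> > 0 \<and>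
        (\<forall>\<alpha>\<in>PE_signals T \<mu>. \<forall>t0\<ge>0. \<forall>x0 x. closed_loop_solution A b K \<alpha> t0 x0 x \<longrightarrow>
           (\<forall>t\<ge>t0. norm (x t) \<le> C * exp (- \<gamma> * (t - t0)) * norm x0)))"

end

theory Submission
  imports Defs "HOL-Complex_Analysis.Complex_Analysis"
    "HOL-Computational_Algebra.Fundamental_Theorem_Algebra"
begin

text \<open>
  A low-gain feedback. Let \<open>\<rho>\<^sub>1, ..., \<rho>\<^sub>n\<close> be the eigenvalues of \<open>A\<close> with multiplicity. For small
  \<open>\<epsilon> > 0\<close> there are linear coordinates \<open>\<zeta>\<^sub>k\<close> in which the system is the cascade
  \<open>\<zeta>\<^sub>k' = \<rho>\<^sub>k \<zeta>\<^sub>k + \<epsilon> (\<zeta>\<^sub>1 + ... + \<zeta>\<^sub>k\<^sub>-\<^sub>1) + \<alpha> u\<close>, and \<open>Y = \<zeta>\<^sub>1 + ... + \<zeta>\<^sub>n\<close> is real because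
  \<open>1 + \<epsilon> Y\<close> has the transfer function \<open>p(s + \<epsilon>) / p(s)\<close> with \<open>p\<close> the characteristic polynomial of \<open>A\<close>.
  With \<open>u = - c \<epsilon> Y\<close> the function \<open>V = \<Sum>\<^sub>k \<bar>\<zeta>\<^sub>k\<bar>\<^sup>2\<close> satisfies \<open>V' \<le> \<epsilon> ((1 - 2 c \<alpha>) Y\<^sup>2 - V)\<close>.
  On a window of length \<open>T\<close> the signal \<open>Y\<close> is \<open>O(\<epsilon>)\<close>-close to an exponential sum \<open>f\<close> with exponents
  \<open>\<rho>\<^sub>k\<close>, and by compactness \<open>\<integral>\<alpha> \<bar>f\<bar>\<^sup>2 \<ge> \<delta> \<integral>\<bar>f\<bar>\<^sup>2\<close> uniformly over all such sums and all signals.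
  Taking \<open>c = 1 / (2 \<delta>)\<close> and then \<open>\<epsilon>\<close> small makes \<open>V\<close> contract over every window.
\<close>

section \<open>Polynomials acting on the control vector\<close>

text \<open>This is \<open>q(A) b\<close>, evaluated by Horner's scheme so that no matrix powers are
  formed.\<close>

definition orbit_poly :: "real^'n^'n \<Rightarrow> real^'n \<Rightarrow> real poly \<Rightarrow> real^'n" where
  "orbit_poly A b q = fold_coeffs (\<lambda>c v. c *\<^sub>R b + A *v v) q 0"

lemma orbit_poly_0 [simp]: "orbit_poly A b 0 = 0"
  by (simp add: orbit_poly_def)

lemma orbit_poly_pCons [simp]: "orbit_poly A b (pCons c q) = c *\<^sub>R b + A *v orbit_poly A b q"
proof (cases "c = 0 \<and> q = 0")
  case False
  then show ?thesis
    by (auto simp: orbit_poly_def fold_coeffs_pCons_coeff_not_0_eq fold_coeffs_pCons_not_0_0_eq)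
qed simp

lemma orbit_poly_add: "orbit_poly A b (q + r) = orbit_poly A b q + orbit_poly A b r"
  by (induction q r rule: poly_induct2) (auto simp: algebra_simps matrix_vector_right_distrib)

lemma orbit_poly_smult: "orbit_poly A b (smult c q) = c *\<^sub>R orbit_poly A b q"
  by (induction q) (auto simp: algebra_simps matrix_vector_mult_scaleR)

lemma orbit_poly_diff: "orbit_poly A b (q - r) = orbit_poly A b q - orbit_poly A b r"
  using orbit_poly_add[of A b q "- r"] orbit_poly_smult[of A b "-1" r] by simp

lemma orbit_poly_mult_zero: "orbit_poly A b p = 0 \<Longrightarrow> orbit_poly A b (p * q) = 0"
  by (induction q) (auto simp: mult_pCons_right orbit_poly_add orbit_poly_smult)

lemma orbit_poly_monom: "orbit_poly A b (monom c i) = c *\<^sub>R (((*v) A ^^ i) b)"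
  by (induction i) (auto simp: monom_0 monom_Suc matrix_vector_mult_scaleR)

lemma orbit_poly_sum: "orbit_poly A b (\<Sum>i\<in>I. f i) = (\<Sum>i\<in>I. orbit_poly A b (f i))"
  by (induction I rule: infinite_finite_induct) (auto simp: orbit_poly_add)

lemma orbit_poly_altdef:
  assumes "degree q < m"
  shows "orbit_poly A b q = (\<Sum>i<m. coeff q i *\<^sub>R (((*v) A ^^ i) b))"
proof -
  have "(\<Sum>i<m. monom (coeff q i) i) = q"
    using assms by (auto intro!: poly_eqI simp: coeff_sum coeff_monom if_distrib coeff_eq_0 cong: if_cong)
  then have "orbit_poly A b q = orbit_poly A b (\<Sum>i<m. monom (coeff q i) i)" by simp
  also have "\<dots> = (\<Sum>i<m. coeff q i *\<^sub>R (((*v) A ^^ i) b))"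
    by (simp add: orbit_poly_sum orbit_poly_monom)
  finally show ?thesis .
qed

text \<open>The Kalman condition concerns a set, in which equal iterates would merge. A spanning set
  needs at least \<open>n\<close> elements, so the \<open>n\<close> iterates are distinct, and a
  spanning set of that size is independent.\<close>

lemma controllable_orbit_basis:
  fixes A :: "real^'n^'n"
  assumes "controllable_pair A b"
  shows "inj_on (\<lambda>i. ((*v) A ^^ i) b) {..<CARD('n)}"
    and "independent ((\<lambda>i. ((*v) A ^^ i) b) ` {..<CARD('n)})"
    and "span ((\<lambda>i. ((*v) A ^^ i) b) ` {..<CARD('n)}) = UNIV"
proof -
  let ?S = "(\<lambda>i. ((*v) A ^^ i) b) ` {..<CARD('n)}"
  have "?S = {((*v) A ^^ k) b | k. k < CARD('n)}" by auto
  then have d: "dim ?S = CARD('n)" using assms by (simp add: controllable_pair_def)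
  show sp: "span ?S = UNIV" using d by (simp flip: dim_eq_full)
  have "card ?S \<le> CARD('n)" using card_image_le[of "{..<CARD('n)}"] by fastforce
  moreover have "CARD('n) \<le> card ?S" using d dim_le_card'[of ?S] by simp
  ultimately have c: "card ?S = CARD('n)" by simp
  then show "inj_on (\<lambda>i. ((*v) A ^^ i) b) {..<CARD('n)}" by (simp add: eq_card_imp_inj_on)
  show "independent ?S"
    using card_eq_dim[of ?S UNIV] c sp by simp
qed

lemma controllable_orbit_poly_surj:
  fixes A :: "real^'n^'n"
  assumes "controllable_pair A b"
  obtains q where "x = orbit_poly A b q" "degree q < CARD('n)"
proof -
  let ?a = "\<lambda>i. ((*v) A ^^ i) b" and ?n = "CARD('n)"
  have "x \<in> span (?a ` {..<?n})" using controllable_orbit_basis(3)[OF assms] by simp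
  then obtain u where "x = (\<Sum>v\<in>?a ` {..<?n}. u v *\<^sub>R v)"
    by (auto simp: span_finite)
  then have x: "x = (\<Sum>i<?n. u (?a i) *\<^sub>R ?a i)"
    by (simp add: sum.reindex[OF controllable_orbit_basis(1)[OF assms]])
  let ?q = "\<Sum>i<?n. monom (u (?a i)) i"
  have "degree ?q < ?n"
    by (rule degree_sum_less) (auto intro: le_less_trans[OF degree_monom_le])
  moreover have "x = orbit_poly A b ?q"
    by (simp add: orbit_poly_sum orbit_poly_monom x)
  ultimately show ?thesis using that by blast
qed

lemma controllable_orbit_poly_inj:
  fixes A :: "real^'n^'n"
  assumes "controllable_pair A b" "orbit_poly A b q = 0" "degree q < CARD('n)"
  shows "q = 0"
proof (rule poly_eqI)
  let ?a = "\<lambda>i. ((*v) A ^^ i) b" and ?n = "CARD('n)"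
  note inj = controllable_orbit_basis(1)[OF assms(1)]
  have "(\<Sum>i<?n. coeff q i *\<^sub>R ?a i) = 0"
    using assms orbit_poly_altdef[of q ?n A b] by simp
  \<comment> \<open>\<open>independentD\<close> takes coefficients indexed by vectors, so each index
    is recovered from its vector by injectivity.\<close>
  then have "(\<Sum>v\<in>?a ` {..<?n}. coeff q (the_inv_into {..<?n} ?a v) *\<^sub>R v) = 0"
    by (subst sum.reindex[OF inj]) (simp add: the_inv_into_f_f[OF inj])
  then have *: "\<forall>v\<in>?a ` {..<?n}. coeff q (the_inv_into {..<?n} ?a v) = 0"
    using independentD[OF controllable_orbit_basis(2)[OF assms(1)] _ order_refl,
        of "\<lambda>v. coeff q (the_inv_into {..<?n} ?a v)"] by blast
  fix i show "coeff q i = coeff 0 i"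
  proof (cases "i < ?n")
    case True
    then show ?thesis using * by (auto simp: the_inv_into_f_f[OF inj])
  next
    case False
    then show ?thesis using assms(3) by (simp add: coeff_eq_0)
  qed
qed

text \<open>As \<open>b\<close> is cyclic, its \<open>n\<close>-th iterate is a combination of the
  lower ones, and this relation is \<open>p\<close>. If \<open>q\<close> annihilates
  \<open>b\<close>, so does its remainder modulo \<open>p\<close>, which has degree below
  \<open>n\<close> and hence vanishes. With \<open>b\<close> cyclic, \<open>p\<close> is the
  characteristic polynomial of \<open>A\<close>.\<close>

lemma controllable_annihilator:
  fixes A :: "real^'n^'n"
  assumes "controllable_pair A b"
  obtains p where "degree p = CARD('n)" "lead_coeff p = 1" "\<And>q. orbit_poly A b q = 0 \<longleftrightarrow> p dvd q"
proof -
  let ?n = "CARD('n)"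
  obtain r where r: "((*v) A ^^ ?n) b = orbit_poly A b r" "degree r < ?n"
    using controllable_orbit_poly_surj[OF assms] by metis
  define p where "p = monom 1 ?n - r"
  have deg: "degree p = ?n"
    unfolding p_def using r(2) by (metis degree_add_eq_left degree_minus degree_monom_eq diff_conv_add_uminus zero_neq_one)
  have "coeff p ?n = 1" using r(2) by (simp add: p_def coeff_eq_0)
  then have lc: "lead_coeff p = 1" by (simp add: deg)
  have p0: "orbit_poly A b p = 0"
    by (simp add: p_def orbit_poly_diff orbit_poly_monom r(1))
  have "p dvd q" if "orbit_poly A b q = 0" for q
  proof -
    have pn: "p \<noteq> 0" using lc by auto
    have "orbit_poly A b (q mod p) = orbit_poly A b (q - p * (q div p))"
      by (simp add: minus_mult_div_eq_mod)
    also have "\<dots> = 0"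
      using orbit_poly_mult_zero[OF p0] that by (simp add: orbit_poly_diff)
    finally have "orbit_poly A b (q mod p) = 0" .
    moreover have "degree (q mod p) < ?n"
      using degree_mod_less[OF pn, of q] deg by (metis degree_0 zero_less_card_finite)
    ultimately have "q mod p = 0" using controllable_orbit_poly_inj[OF assms] by blast
    then show ?thesis by auto
  qed
  moreover have "orbit_poly A b q = 0" if "p dvd q" for q
    using that orbit_poly_mult_zero[OF p0] by (auto elim: dvdE)
  ultimately show ?thesis using that[OF deg lc] by blast
qed

section \<open>Complex polynomials and eigenvalues\<close>

definition complex_orbit_poly :: "real^'n^'n \<Rightarrow> real^'n \<Rightarrow> complex poly \<Rightarrow> complex^'n" where
  "complex_orbit_poly A b q =
     (\<chi> i. Complex (orbit_poly A b (map_poly Re q) $ i) (orbit_poly A b (map_poly Im q) $ i))"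

lemma map_poly_Re_diff: "map_poly Re (p - q) = map_poly Re p - map_poly Re q"
  by (rule poly_eqI) (simp add: coeff_map_poly)

lemma map_poly_Im_diff: "map_poly Im (p - q) = map_poly Im p - map_poly Im q"
  by (rule poly_eqI) (simp add: coeff_map_poly)

lemma map_poly_Re_smult:
  "map_poly Re (smult c q) = smult (Re c) (map_poly Re q) - smult (Im c) (map_poly Im q)"
  by (rule poly_eqI) (simp add: coeff_map_poly)

lemma map_poly_Im_smult:
  "map_poly Im (smult c q) = smult (Re c) (map_poly Im q) + smult (Im c) (map_poly Re q)"
  by (rule poly_eqI) (simp add: coeff_map_poly)

lemma complex_orbit_poly_pCons_0:
  "complex_orbit_poly A b (pCons 0 q) = map_matrix complex_of_real A *v complex_orbit_poly A b q"
  by (simp add: complex_orbit_poly_def map_poly_pCons vec_eq_iff matrix_vector_mult_def complex_eq_iff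
       map_matrix_def)

lemma complex_orbit_poly_diff:
  "complex_orbit_poly A b (p - q) = complex_orbit_poly A b p - complex_orbit_poly A b q"
  by (simp add: complex_orbit_poly_def map_poly_Re_diff map_poly_Im_diff orbit_poly_diff
       vec_eq_iff complex_eq_iff)

lemma complex_orbit_poly_smult:
  "complex_orbit_poly A b (smult c q) = c *s complex_orbit_poly A b q"
  by (simp add: complex_orbit_poly_def map_poly_Re_smult map_poly_Im_smult orbit_poly_diff
       orbit_poly_add orbit_poly_smult vec_eq_iff complex_eq_iff)

text \<open>If \<open>p = (s - z) r\<close>, then \<open>A - z\<close> sends the complex vector
  \<open>r(A) b\<close> to \<open>p(A) b = 0\<close>. That vector is an eigenvector: the real and
  imaginary parts of \<open>r\<close> have degree below \<open>n\<close>, so they annihilate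
  \<open>b\<close> only if both are zero.\<close>

lemma complex_eigenvalue_annihilator_root:
  fixes A :: "real^'n^'n"
  assumes "controllable_pair A b" "orbit_poly A b p = 0" "degree p = CARD('n)"
    and "poly (map_poly complex_of_real p) z = 0"
  shows "complex_eigenvalue A z"
proof -
  let ?P = "map_poly complex_of_real p"
  obtain r where r: "?P = [:-z, 1:] * r"
    using assms(4) by (auto simp: poly_eq_0_iff_dvd elim: dvdE)
  have degP: "degree ?P = CARD('n)" using assms(3) by (simp add: degree_map_poly)
  then have rn: "r \<noteq> 0" using r by auto
  then have degr: "degree r < CARD('n)"
    using degP unfolding r by (subst (asm) degree_mult_eq) auto
  have Pr: "?P = pCons 0 r - smult z r" using r by simp
  have "complex_orbit_poly A b ?P = 0"
  proof -
    have "map_poly Re ?P = p" "map_poly Im ?P = 0"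
      by (auto intro!: poly_eqI simp: coeff_map_poly)
    then show ?thesis using assms(2) by (simp add: complex_orbit_poly_def vec_eq_iff complex_eq_iff)
  qed
  then have "map_matrix complex_of_real A *v complex_orbit_poly A b r = z *s complex_orbit_poly A b r"
    unfolding Pr complex_orbit_poly_diff complex_orbit_poly_smult complex_orbit_poly_pCons_0 by simp
  moreover have "complex_orbit_poly A b r \<noteq> 0"
  proof
    assume "complex_orbit_poly A b r = 0"
    then have 0: "orbit_poly A b (map_poly Re r) = 0" "orbit_poly A b (map_poly Im r) = 0"
      by (auto simp: complex_orbit_poly_def vec_eq_iff complex_eq_iff)
    have "degree (map_poly Re r) < CARD('n)" "degree (map_poly Im r) < CARD('n)"
      using degr by (auto intro: le_less_trans[OF map_poly_degree_leq])
    then have "map_poly Re r = 0" "map_poly Im r = 0"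
      using 0 controllable_orbit_poly_inj[OF assms(1)] by auto
    then have "r = 0"
      by (metis coeff_map_poly complex_eq_iff poly_eqI coeff_0 zero_complex.sel)
    then show False using rn by simp
  qed
  ultimately show ?thesis by (auto simp: complex_eigenvalue_def)
qed

section \<open>Cascade coordinates\<close>

text \<open>
  \<open>mode \<epsilon> \<rho> k q\<close> is the coordinate \<open>\<zeta>\<^sub>k\<close> of the state \<open>q(A) b\<close>. In terms of transfer functions,
  \<open>cascade \<epsilon> \<rho> k q\<close> is the polynomial part of \<open>q(s) \<cdot> \<Prod>\<^sub>j\<^sub><\<^sub>k (s - \<rho>\<^sub>j + \<epsilon>) / (s - \<rho>\<^sub>j)\<close>.
\<close>
fun cascade :: "real \<Rightarrow> (nat \<Rightarrow> complex) \<Rightarrow> nat \<Rightarrow> complex poly \<Rightarrow> complex poly" where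
  "cascade \<epsilon> \<rho> 0 q = q"
| "cascade \<epsilon> \<rho> (Suc k) q =
     cascade \<epsilon> \<rho> k q + smult (of_real \<epsilon>) (synthetic_div (cascade \<epsilon> \<rho> k q) (\<rho> k))"

definition mode :: "real \<Rightarrow> (nat \<Rightarrow> complex) \<Rightarrow> nat \<Rightarrow> complex poly \<Rightarrow> complex" where
  "mode \<epsilon> \<rho> k q = poly (cascade \<epsilon> \<rho> k q) (\<rho> k)"

section \<open>Linearity of the cascade, a single stage, and multiplication by
  \<open>s\<close>\<close>

lemma synthetic_div_add: "synthetic_div (p + q) c = synthetic_div p c + synthetic_div q (c :: 'a :: comm_semiring_0)"
  by (induction p q rule: poly_induct2) auto

lemma synthetic_div_smult: "synthetic_div (smult a p) c = smult a (synthetic_div p (c :: 'a :: comm_semiring_0))"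
  by (induction p) auto

lemma cascade_add: "cascade \<epsilon> \<rho> k (p + q) = cascade \<epsilon> \<rho> k p + cascade \<epsilon> \<rho> k q"
  by (induction k) (auto simp: synthetic_div_add smult_add_right algebra_simps)

lemma cascade_smult: "cascade \<epsilon> \<rho> k (smult a q) = smult a (cascade \<epsilon> \<rho> k q)"
  by (induction k) (auto simp: synthetic_div_smult smult_add_right algebra_simps)

lemma mode_add: "mode \<epsilon> \<rho> k (p + q) = mode \<epsilon> \<rho> k p + mode \<epsilon> \<rho> k q"
  by (simp add: mode_def cascade_add)

lemma mode_smult: "mode \<epsilon> \<rho> k (smult a q) = a * mode \<epsilon> \<rho> k q"
  by (simp add: mode_def cascade_smult)

lemma mode_diff: "mode \<epsilon> \<rho> k (p - q) = mode \<epsilon> \<rho> k p - mode \<epsilon> \<rho> k q"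
  using mode_add[of \<epsilon> \<rho> k p "- q"] mode_smult[of \<epsilon> \<rho> k "-1" q] by simp

text \<open>\<open>synthetic_div\<close> is the quotient by \<open>s - \<rho> k\<close> and
  \<open>mode\<close> the remainder. A stage thus multiplies by
  \<open>(s - \<rho> k + \<epsilon>) / (s - \<rho> k)\<close> and drops the fractional part; here
  the denominator is cleared.\<close>

lemma cascade_step:
  "[:- \<rho> k, 1:] * cascade \<epsilon> \<rho> (Suc k) q =
     [:of_real \<epsilon> - \<rho> k, 1:] * cascade \<epsilon> \<rho> k q - [:of_real \<epsilon> * mode \<epsilon> \<rho> k q:]"
proof -
  let ?C = "cascade \<epsilon> \<rho> k q"
  have *: "[:- \<rho> k, 1:] * synthetic_div ?C (\<rho> k) = ?C - [:mode \<epsilon> \<rho> k q:]"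
    using synthetic_div_correct'[of "\<rho> k" ?C] by (simp add: mode_def algebra_simps)
  have "[:- \<rho> k, 1:] * cascade \<epsilon> \<rho> (Suc k) q =
      [:- \<rho> k, 1:] * ?C + smult (of_real \<epsilon>) ([:- \<rho> k, 1:] * synthetic_div ?C (\<rho> k))"
    by (simp only: cascade.simps distrib_left mult_smult_right)
  also have "\<dots> = [:of_real \<epsilon> - \<rho> k, 1:] * ?C - [:of_real \<epsilon> * mode \<epsilon> \<rho> k q:]"
    unfolding * by (simp add: smult_diff_right algebra_simps flip: smult_add_left)
  finally show ?thesis .
qed

lemma cascade_step_mode_0:
  "mode \<epsilon> \<rho> k q = 0 \<Longrightarrow>
    [:- \<rho> k, 1:] * cascade \<epsilon> \<rho> (Suc k) q = [:of_real \<epsilon> - \<rho> k, 1:] * cascade \<epsilon> \<rho> k q"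
  unfolding cascade_step by simp

text \<open>\<open>pCons 0 q\<close> is \<open>s q\<close>, which represents \<open>A x\<close> when
  \<open>q\<close> represents \<open>x\<close>. Dividing \<open>s C\<close> by
  \<open>s - \<rho> k\<close> puts the remainder of \<open>C\<close> into the constant coefficient,
  so every stage adds \<open>\<epsilon>\<close> times its mode there. This is the source of the
  triangular coupling.\<close>

lemma cascade_pCons_0:
  "cascade \<epsilon> \<rho> k (pCons 0 q) = pCons (of_real \<epsilon> * (\<Sum>j<k. mode \<epsilon> \<rho> j q)) (cascade \<epsilon> \<rho> k q)"
  by (induction k) (auto simp: mode_def algebra_simps)

lemma mode_pCons_0:
  "mode \<epsilon> \<rho> k (pCons 0 q) = \<rho> k * mode \<epsilon> \<rho> k q + of_real \<epsilon> * (\<Sum>j<k. mode \<epsilon> \<rho> j q)"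
  by (simp add: mode_def cascade_pCons_0)

lemma cascade_1: "cascade \<epsilon> \<rho> k 1 = 1"
  by (induction k) (auto simp: one_pCons)

lemma mode_1: "mode \<epsilon> \<rho> k 1 = 1"
  by (simp add: mode_def cascade_1)

section \<open>Modes as separating functionals of the state\<close>

lemma cascade_multiple:
  assumes "k \<le> n"
  shows "\<exists>d'. cascade \<epsilon> \<rho> k ((\<Prod>j<n. [:- \<rho> j, 1:]) * d) = (\<Prod>j\<in>{k..<n}. [:- \<rho> j, 1:]) * d'"
  using assms
proof (induction k)
  case 0
  then show ?case by (auto simp: atLeast0LessThan)
next
  case (Suc k)
  let ?q = "(\<Prod>j<n. [:- \<rho> j, 1:]) * d"
  obtain d' where d': "cascade \<epsilon> \<rho> k ?q = (\<Prod>j\<in>{k..<n}. [:- \<rho> j, 1:]) * d'"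
    using Suc by auto
  have spl: "(\<Prod>j\<in>{k..<n}. [:- \<rho> j, 1:]) = [:- \<rho> k, 1:] * (\<Prod>j\<in>{Suc k..<n}. [:- \<rho> j, 1:])"
    using Suc.prems by (simp add: prod.atLeast_Suc_lessThan)
  have m0: "mode \<epsilon> \<rho> k ?q = 0"
    unfolding mode_def d' spl by (simp only: poly_mult) simp
  \<comment> \<open>Without remainder the stage is exact: it trades the factor
    \<open>s - \<rho> k\<close> for \<open>s - \<rho> k + \<epsilon>\<close> and leaves the later
    factors intact.\<close>
  have "[:- \<rho> k, 1:] * cascade \<epsilon> \<rho> (Suc k) ?q =
      [:- \<rho> k, 1:] * ((\<Prod>j\<in>{Suc k..<n}. [:- \<rho> j, 1:]) * ([:of_real \<epsilon> - \<rho> k, 1:] * d'))"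
    unfolding cascade_step_mode_0[OF m0] d' spl by (simp only: mult_ac)
  then have "cascade \<epsilon> \<rho> (Suc k) ?q = (\<Prod>j\<in>{Suc k..<n}. [:- \<rho> j, 1:]) * ([:of_real \<epsilon> - \<rho> k, 1:] * d')"
    by (subst (asm) mult_left_cancel) auto
  then show ?case by blast
qed

text \<open>Two polynomials representing the same state differ by a multiple of the annihilator, so
  this makes \<open>mode\<close> a function of the state. Before stage \<open>k\<close> the factor
  \<open>s - \<rho> k\<close> is still present, hence the value at \<open>\<rho> k\<close> is
  zero.\<close>

lemma mode_multiple_eq_0:
  assumes "k < n" "(\<Prod>j<n. [:- \<rho> j, 1:]) dvd q"
  shows "mode \<epsilon> \<rho> k q = 0"
proof -
  obtain d where d: "q = (\<Prod>j<n. [:- \<rho> j, 1:]) * d" using assms(2) by (elim dvdE)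
  obtain d' where d': "cascade \<epsilon> \<rho> k q = (\<Prod>j\<in>{k..<n}. [:- \<rho> j, 1:]) * d'"
    using cascade_multiple[of k n \<epsilon> \<rho> d] assms(1) d by auto
  have "k \<in> {k..<n}" using assms(1) by simp
  then have "poly (\<Prod>j\<in>{k..<n}. [:- \<rho> j, 1:]) (\<rho> k) = 0"
    unfolding poly_prod by (intro prod_zero) auto
  then show ?thesis by (simp add: mode_def d')
qed

lemma cascade_modes_0:
  assumes "\<And>j. j < k \<Longrightarrow> mode \<epsilon> \<rho> j q = 0"
  shows "(\<Prod>j<k. [:- \<rho> j, 1:]) * cascade \<epsilon> \<rho> k q = (\<Prod>j<k. [:of_real \<epsilon> - \<rho> j, 1:]) * q"
  using assms
proof (induction k)
  case (Suc k)
  have "(\<Prod>j<Suc k. [:- \<rho> j, 1:]) * cascade \<epsilon> \<rho> (Suc k) q =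
      (\<Prod>j<k. [:- \<rho> j, 1:]) * ([:- \<rho> k, 1:] * cascade \<epsilon> \<rho> (Suc k) q)"
    by (simp only: prod.lessThan_Suc mult_ac)
  also have "\<dots> = [:of_real \<epsilon> - \<rho> k, 1:] * ((\<Prod>j<k. [:- \<rho> j, 1:]) * cascade \<epsilon> \<rho> k q)"
    unfolding cascade_step_mode_0[OF Suc.prems[OF lessI]] by (simp only: mult_ac)
  also have "\<dots> = (\<Prod>j<Suc k. [:of_real \<epsilon> - \<rho> j, 1:]) * q"
    using Suc by (simp only: prod.lessThan_Suc mult_ac less_SucI)
  finally show ?case .
qed simp

text \<open>Roots may repeat, so it is not enough that each of them is a zero of \<open>q\<close>;
  the linear factors are split off one at a time.\<close>

lemma prod_linear_dvd_cancel:
  fixes c :: "'a :: field poly" and \<rho> :: "nat \<Rightarrow> 'a"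
  assumes "(\<Prod>j<n. [:- \<rho> j, 1:]) dvd c * q" "\<And>j. j < n \<Longrightarrow> poly c (\<rho> j) \<noteq> 0"
  shows "(\<Prod>j<n. [:- \<rho> j, 1:]) dvd q"
  using assms
proof (induction n arbitrary: q)
  case (Suc n)
  have "[:- \<rho> n, 1:] dvd c * q"
    by (rule dvd_trans[OF _ Suc.prems(1)]) (simp only: prod.lessThan_Suc dvd_triv_right)
  then have "poly q (\<rho> n) = 0" using Suc.prems(2)[of n] by (simp add: poly_eq_0_iff_dvd[symmetric])
  then obtain q' where q': "q = [:- \<rho> n, 1:] * q'" by (auto simp: poly_eq_0_iff_dvd)
  have "[:- \<rho> n, 1:] * (\<Prod>j<n. [:- \<rho> j, 1:]) dvd [:- \<rho> n, 1:] * (c * q')"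
    using Suc.prems(1) unfolding q' by (simp only: prod.lessThan_Suc mult_ac)
  then have "(\<Prod>j<n. [:- \<rho> j, 1:]) dvd c * q'"
    using dvd_mult_cancel_left[of "[:- \<rho> n, 1:]"] by (metis pCons_eq_0_iff one_neq_zero)
  then have "(\<Prod>j<n. [:- \<rho> j, 1:]) dvd q'"
    by (rule Suc.IH) (rule Suc.prems(2), simp)
  then have "[:- \<rho> n, 1:] * (\<Prod>j<n. [:- \<rho> j, 1:]) dvd q"
    unfolding q' by (rule mult_dvd_mono[OF dvd_refl])
  then show ?case by (simp only: prod.lessThan_Suc mult_ac)
qed simp

text \<open>If all modes vanish, every stage is exact and \<open>p(s)\<close> divides
  \<open>p(s + \<epsilon>) q(s)\<close>, where \<open>p\<close> is the product of the factors
  \<open>s - \<rho> j\<close>. The second hypothesis says that \<open>p(s)\<close> and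
  \<open>p(s + \<epsilon>)\<close> have no common root, so \<open>p\<close> divides
  \<open>q\<close>. Thus the modes separate states.\<close>

lemma modes_0_imp_dvd:
  assumes "\<And>j. j < n \<Longrightarrow> mode \<epsilon> \<rho> j q = 0"
    and "\<And>i j. i < n \<Longrightarrow> j < n \<Longrightarrow> \<rho> i - \<rho> j + of_real \<epsilon> \<noteq> 0"
  shows "(\<Prod>j<n. [:- \<rho> j, 1:]) dvd q"
proof (rule prod_linear_dvd_cancel)
  show "(\<Prod>j<n. [:- \<rho> j, 1:]) dvd (\<Prod>j<n. [:of_real \<epsilon> - \<rho> j, 1:]) * q"
    using cascade_modes_0[of n \<epsilon> \<rho> q, OF assms(1)] by (metis dvd_triv_left)
  show "poly (\<Prod>j<n. [:of_real \<epsilon> - \<rho> j, 1:]) (\<rho> i) \<noteq> 0" if "i < n" for i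
    using assms(2)[OF that] by (auto simp: poly_prod algebra_simps)
qed

text \<open>Here the remainders of the stages are kept, and together they stay of degree below
  \<open>k\<close>. The bound is put in terms of coefficients because for \<open>k = 0\<close> it
  must say \<open>r = 0\<close>, which no bound on \<open>degree\<close> expresses.\<close>

lemma cascade_remainder:
  "\<exists>r. (\<forall>i\<ge>k. coeff r i = 0) \<and>
     (\<Prod>j<k. [:- \<rho> j, 1:]) * cascade \<epsilon> \<rho> k q = (\<Prod>j<k. [:of_real \<epsilon> - \<rho> j, 1:]) * q + r"
proof (induction k)
  case 0
  show ?case by (rule exI[of _ 0]) simp
next
  case (Suc k)
  let ?P = "\<lambda>k. \<Prod>j<k. [:- \<rho> j, 1:]" and ?Q = "\<lambda>k. \<Prod>j<k. [:of_real \<epsilon> - \<rho> j, 1:]"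
  let ?c = "of_real \<epsilon> * mode \<epsilon> \<rho> k q"
  obtain r where r: "\<forall>i\<ge>k. coeff r i = 0" "?P k * cascade \<epsilon> \<rho> k q = ?Q k * q + r"
    using Suc by blast
  let ?r = "[:of_real \<epsilon> - \<rho> k, 1:] * r - smult ?c (?P k)"
  have degP: "degree (?P k) = k" by (subst degree_prod_eq_sum_degree) auto
  have "?P (Suc k) * cascade \<epsilon> \<rho> (Suc k) q = ?P k * ([:- \<rho> k, 1:] * cascade \<epsilon> \<rho> (Suc k) q)"
    by (simp only: prod.lessThan_Suc mult_ac)
  also have "\<dots> = [:of_real \<epsilon> - \<rho> k, 1:] * (?P k * cascade \<epsilon> \<rho> k q) - smult ?c (?P k)"
    unfolding cascade_step by (simp only: right_diff_distrib mult_ac) (simp add: mult.commute)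
  also have "\<dots> = ?Q (Suc k) * q + ?r"
    unfolding r(2) by (simp only: prod.lessThan_Suc distrib_left mult_ac add_ac diff_conv_add_uminus)
  finally have "?P (Suc k) * cascade \<epsilon> \<rho> (Suc k) q = ?Q (Suc k) * q + ?r" .
  moreover have "\<forall>i\<ge>Suc k. coeff ?r i = 0"
  proof (intro allI impI)
    fix i assume "i \<ge> Suc k"
    moreover from this obtain i' where "i = Suc i'" "i' \<ge> k" by (cases i) auto
    ultimately show "coeff ?r i = 0"
      using r(1) by (simp add: coeff_eq_0 degP)
  qed
  ultimately show ?case by blast
qed

text \<open>
  By the previous lemma the last stage is the quotient of \<open>q(s) p(s + \<epsilon>)\<close> by \<open>p(s)\<close>; division with
  remainder is unique, so the quotient is real whenever \<open>p\<close> and \<open>q\<close> are.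
\<close>
lemma cascade_real:
  assumes P: "(\<Prod>j<n. [:- \<rho> j, 1:]) = map_poly of_real p"
  shows "map_poly cnj (cascade \<epsilon> \<rho> n (map_poly of_real q)) = cascade \<epsilon> \<rho> n (map_poly of_real q)"
proof -
  let ?P = "\<Prod>j<n. [:- \<rho> j, 1:]" and ?Q = "\<Prod>j<n. [:of_real \<epsilon> - \<rho> j, 1:]"
  let ?q = "map_poly complex_of_real q"
  let ?C = "cascade \<epsilon> \<rho> n ?q"
  have cnj_mult: "map_poly cnj (u * v) = map_poly cnj u * map_poly cnj v" for u v
    by (rule poly_eqI) (simp add: coeff_map_poly coeff_mult)
  have cnj_add: "map_poly cnj (u + v) = map_poly cnj u + map_poly cnj v" for u v
    by (rule poly_eqI) (simp add: coeff_map_poly)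
  have cnj_real: "map_poly cnj (map_poly complex_of_real u) = map_poly complex_of_real u" for u
    by (rule poly_eqI) (simp add: coeff_map_poly)
  have shift_real: "map_poly complex_of_real (pcompose u [:\<epsilon>, 1:]) =
      pcompose (map_poly of_real u) [:of_real \<epsilon>, 1:]" for u
  proof (induction u)
    case (pCons a u)
    have "map_poly complex_of_real ([:a:] + [:\<epsilon>, 1:] * v) =
        [:of_real a:] + [:of_real \<epsilon>, 1:] * map_poly of_real v" for v
      by (rule poly_eqI) (auto simp: coeff_map_poly coeff_pCons split: nat.splits)
    then show ?case using pCons by (simp only: pcompose_pCons map_poly_pCons of_real_0)
  qed simp
  have P_real: "map_poly cnj ?P = ?P" unfolding P by (rule cnj_real)
  \<comment> \<open>\<open>?Q\<close> is \<open>p(s + \<epsilon>)\<close>, a real polynomial because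
    \<open>p\<close> and \<open>\<epsilon>\<close> are real.\<close>
  have Q_shift: "?Q = pcompose ?P [:of_real \<epsilon>, 1:]"
    by (simp add: pcompose_prod pcompose_pCons)
  have "?Q = map_poly complex_of_real (pcompose p [:\<epsilon>, 1:])"
    unfolding Q_shift P by (simp only: shift_real)
  then have Q_real: "map_poly cnj ?Q = ?Q" using cnj_real by metis
  obtain r where r: "\<forall>i\<ge>n. coeff r i = 0" "?P * ?C = ?Q * ?q + r"
    using cascade_remainder by blast
  have "?P * map_poly cnj ?C = ?Q * ?q + map_poly cnj r"
    using arg_cong[OF r(2), of "map_poly cnj"] by (simp add: cnj_mult cnj_add P_real Q_real cnj_real)
  then have eq: "?P * (?C - map_poly cnj ?C) = r - map_poly cnj r"
    using r(2) by (simp add: right_diff_distrib)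
  have degP: "degree ?P = n" by (subst degree_prod_eq_sum_degree) auto
  have "?C - map_poly cnj ?C = 0"
  proof (rule ccontr)
    let ?D = "?C - map_poly cnj ?C"
    assume D: "?D \<noteq> 0"
    then have "degree (?P * ?D) = n + degree ?D"
      using degP by (subst degree_mult_eq) auto
    moreover have "coeff (?P * ?D) (n + degree ?D) = 0"
      unfolding eq using r(1) by (simp add: coeff_map_poly)
    ultimately have "?P * ?D = 0" by (metis leading_coeff_0_iff)
    then show False using D by auto
  qed
  then show ?thesis by simp
qed

text \<open>By \<open>cascade_pCons_0\<close>, \<open>\<epsilon>\<close> times the sum is the
  constant coefficient of the last stage for \<open>s q\<close>, and that stage has real
  coefficients.\<close>

lemma sum_mode_real:
  assumes "(\<Prod>j<n. [:- \<rho> j, 1:]) = map_poly of_real p"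
    and "\<epsilon> \<noteq> 0"
  shows "Im (\<Sum>j<n. mode \<epsilon> \<rho> j (map_poly of_real q)) = 0"
proof -
  let ?q = "map_poly complex_of_real q"
  have "map_poly complex_of_real (pCons 0 q) = pCons 0 ?q" by (simp add: map_poly_pCons)
  then have "map_poly cnj (cascade \<epsilon> \<rho> n (pCons 0 ?q)) = cascade \<epsilon> \<rho> n (pCons 0 ?q)"
    using cascade_real[OF assms(1), of \<epsilon> "pCons 0 q"] by simp
  then have "cnj (of_real \<epsilon> * (\<Sum>j<n. mode \<epsilon> \<rho> j ?q)) = of_real \<epsilon> * (\<Sum>j<n. mode \<epsilon> \<rho> j ?q)"
    unfolding cascade_pCons_0 by (simp add: map_poly_pCons)
  then show ?thesis using assms(2)
    by (metis complex_cnj_complex_of_real complex_cnj_mult mult_left_cancel of_real_eq_0_iff Reals_cnj_iff complex_is_Real_iff)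
qed

text \<open>The interface between algebra and analysis: after the next lemma the estimates use only
  these properties and the sign of \<open>Re (\<rho> k)\<close>. Here \<open>linear\<close> means
  real-linear, as complex functionals act on a real space.\<close>

definition modal_coordinates ::
  "real^'n^'n \<Rightarrow> real^'n \<Rightarrow> real \<Rightarrow> (nat \<Rightarrow> complex) \<Rightarrow> (nat \<Rightarrow> real^'n \<Rightarrow> complex) \<Rightarrow> bool" where
  "modal_coordinates A b \<epsilon> \<rho> \<zeta> \<longleftrightarrow>
     (\<forall>k<CARD('n). linear (\<zeta> k) \<and> \<zeta> k b = 1 \<and>
        (\<forall>x. \<zeta> k (A *v x) = \<rho> k * \<zeta> k x + of_real \<epsilon> * (\<Sum>j<k. \<zeta> j x))) \<and>
     (\<forall>x. Im (\<Sum>k<CARD('n). \<zeta> k x) = 0) \<and>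
     (\<forall>x. (\<forall>k<CARD('n). \<zeta> k x = 0) \<longrightarrow> x = 0)"

text \<open>The numbers \<open>\<rho> k\<close> are the roots of the annihilator with multiplicity.
  They are fixed before \<open>\<epsilon>\<close>, so that the gain, which depends on them, can be
  chosen before \<open>\<epsilon>\<close> as well.\<close>

lemma controllable_imp_modal_coordinates:
  fixes A :: "real^'n^'n"
  assumes contr: "controllable_pair A b"
  obtains \<rho> \<epsilon>0 where "\<And>k. k < CARD('n) \<Longrightarrow> complex_eigenvalue A (\<rho> k)" "\<epsilon>0 > 0"
    "\<And>\<epsilon>. 0 < \<epsilon> \<Longrightarrow> \<epsilon> < \<epsilon>0 \<Longrightarrow> \<exists>\<zeta>. modal_coordinates A b \<epsilon> \<rho> \<zeta>"
proof -
  let ?n = "CARD('n)" and ?ev = "orbit_poly A b"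
  let ?R = "map_poly complex_of_real"
  obtain p where p: "degree p = ?n" "lead_coeff p = 1" "\<And>q. ?ev q = 0 \<longleftrightarrow> p dvd q"
    using controllable_annihilator[OF contr] by metis
  obtain \<rho> where "smult (lead_coeff (?R p)) (\<Prod>i<degree (?R p). [:- \<rho> i, 1:]) = ?R p"
    using complex_poly_decompose' by blast
  then have P: "(\<Prod>j<?n. [:- \<rho> j, 1:]) = ?R p"
    using p by (simp add: degree_map_poly coeff_map_poly)
  have eig: "complex_eigenvalue A (\<rho> k)" if "k < ?n" for k
  proof (rule complex_eigenvalue_annihilator_root[OF contr _ p(1)])
    show "?ev p = 0" by (simp add: p(3))
    show "poly (?R p) (\<rho> k) = 0"
      unfolding P[symmetric] poly_prod using that by (intro prod_zero) auto
  qed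
  \<comment> \<open>\<open>D\<close> holds the nonzero distances between roots, and 1 to be
    nonempty. Below its minimum \<open>\<epsilon>\<close> is not a difference of two roots, as
    \<open>modes_0_imp_dvd\<close> requires.\<close>
  define D where "D = insert 1 ((\<lambda>(i, j). cmod (\<rho> i - \<rho> j)) ` ({..<?n} \<times> {..<?n}) - {0})"
  have finD: "finite D" by (simp add: D_def)
  define \<epsilon>0 where "\<epsilon>0 = Min D"
  have "\<epsilon>0 \<in> D" unfolding \<epsilon>0_def using finD by (intro Min_in) (auto simp: D_def)
  then have \<epsilon>0: "\<epsilon>0 > 0" by (auto simp: D_def)
  have coords: "\<exists>\<zeta>. modal_coordinates A b \<epsilon> \<rho> \<zeta>" if \<epsilon>: "0 < \<epsilon>" "\<epsilon> < \<epsilon>0" for \<epsilon>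
  proof -
    have sep: "\<rho> i - \<rho> j + of_real \<epsilon> \<noteq> 0" if "i < ?n" "j < ?n" for i j
    proof
      assume "\<rho> i - \<rho> j + of_real \<epsilon> = 0"
      then have "\<rho> i - \<rho> j = - of_real \<epsilon>" by (simp add: eq_neg_iff_add_eq_0)
      then have d: "cmod (\<rho> i - \<rho> j) = \<epsilon>" using \<epsilon> by simp
      have "cmod (\<rho> i - \<rho> j) \<in> D"
      proof -
        have "(\<lambda>(i, j). cmod (\<rho> i - \<rho> j)) (i, j) \<in> (\<lambda>(i, j). cmod (\<rho> i - \<rho> j)) ` ({..<?n} \<times> {..<?n})"
          by (rule imageI) (simp add: that)
        then show ?thesis unfolding D_def using \<epsilon>(1) d by simp
      qed
      then show False using \<epsilon> Min_le[OF finD, of \<epsilon>] d by (simp add: \<epsilon>0_def)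
    qed
    define m where "m k q = mode \<epsilon> \<rho> k (?R q)" for k q
    \<comment> \<open>Any polynomial representing \<open>x\<close> will do; \<open>m_cong\<close>
      below makes the choice harmless.\<close>
    define \<zeta> where "\<zeta> k x = m k (SOME q. x = ?ev q)" for k x
    have R_add: "?R (q + r) = ?R q + ?R r" for q r
      by (rule poly_eqI) (simp add: coeff_map_poly)
    have R_diff: "?R (q - r) = ?R q - ?R r" for q r
      by (rule poly_eqI) (simp add: coeff_map_poly)
    have R_smult: "?R (smult c q) = smult (of_real c) (?R q)" for c q
      by (rule poly_eqI) (simp add: coeff_map_poly)
    have R_mult: "?R (q * r) = ?R q * ?R r" for q r
      by (rule poly_eqI) (simp add: coeff_map_poly coeff_mult)
    have R_1: "?R 1 = 1" by (simp add: one_pCons map_poly_pCons)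
    have m_cong: "m k q = m k r" if "k < ?n" "?ev q = ?ev r" for k q r
    proof -
      have "p dvd q - r" using that(2) by (simp flip: p(3) add: orbit_poly_diff)
      then have "?R p dvd ?R (q - r)" by (metis R_mult dvd_def)
      then have "mode \<epsilon> \<rho> k (?R (q - r)) = 0"
        by (intro mode_multiple_eq_0[OF that(1)]) (simp add: P)
      then show ?thesis by (simp add: m_def R_diff mode_diff)
    qed
    have \<zeta>: "\<zeta> k (?ev q) = m k q" if "k < ?n" for k q
      unfolding \<zeta>_def by (rule m_cong[OF that]) (rule sym, rule someI[of _ q], rule refl)
    have surj: "\<exists>q. x = ?ev q" for x
      using controllable_orbit_poly_surj[OF contr] by metis
    have l1: "linear (\<zeta> k)" if k: "k < ?n" for k
    proof (rule linearI)
      fix x y :: "real^'n" and c :: real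
      obtain q r where qr: "x = ?ev q" "y = ?ev r" using surj by metis
      show "\<zeta> k (x + y) = \<zeta> k x + \<zeta> k y"
        unfolding qr by (simp flip: orbit_poly_add add: \<zeta>[OF k]) (simp add: m_def R_add mode_add)
      show "\<zeta> k (c *\<^sub>R x) = c *\<^sub>R \<zeta> k x"
        unfolding qr by (simp flip: orbit_poly_smult add: \<zeta>[OF k])
          (simp add: m_def R_smult mode_smult scaleR_conv_of_real)
    qed
    have l2: "\<zeta> k b = 1" if k: "k < ?n" for k
    proof -
      have "b = ?ev 1" by (simp add: one_pCons)
      then show ?thesis using \<zeta>[OF k, of 1] by (simp add: m_def R_1 mode_1)
    qed
    have l3: "\<zeta> k (A *v x) = \<rho> k * \<zeta> k x + of_real \<epsilon> * (\<Sum>j<k. \<zeta> j x)" if k: "k < ?n" for k x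
    proof -
      obtain q where q: "x = ?ev q" using surj by metis
      have Ax: "A *v x = ?ev (pCons 0 q)" by (simp add: q)
      have "(\<Sum>j<k. \<zeta> j x) = (\<Sum>j<k. m j q)" using k by (simp add: q \<zeta>)
      then show ?thesis unfolding Ax \<zeta>[OF k] unfolding q \<zeta>[OF k]
        by (simp add: m_def map_poly_pCons mode_pCons_0)
    qed
    have l4: "Im (\<Sum>k<?n. \<zeta> k x) = 0" for x
    proof -
      obtain q where q: "x = ?ev q" using surj by metis
      have "(\<Sum>k<?n. \<zeta> k x) = (\<Sum>k<?n. mode \<epsilon> \<rho> k (?R q))" by (simp add: q \<zeta> m_def)
      then show ?thesis using sum_mode_real[OF P] \<epsilon>(1) by simp
    qed
    have l5: "x = 0" if "\<forall>k<?n. \<zeta> k x = 0" for x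
    proof -
      obtain q where q: "x = ?ev q" "degree q < ?n"
        using controllable_orbit_poly_surj[OF contr] by metis
      have "mode \<epsilon> \<rho> k (?R q) = 0" if "k < ?n" for k
        using \<open>\<forall>k<?n. \<zeta> k x = 0\<close> that by (simp add: q \<zeta> m_def)
      then have dvd: "?R p dvd ?R q"
        unfolding P[symmetric] using sep by (intro modes_0_imp_dvd)
      have "?R q = 0"
      proof (rule ccontr)
        assume "?R q \<noteq> 0"
        then have "degree (?R p) \<le> degree (?R q)" by (rule dvd_imp_degree_le[OF dvd])
        then show False using p q(2) by (simp add: degree_map_poly)
      qed
      then have "q = 0" by (metis coeff_0 coeff_map_poly of_real_0 of_real_eq_0_iff poly_eqI)
      then show ?thesis using q by simp
    qed
    show ?thesis unfolding modal_coordinates_def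
    proof (intro exI[of _ \<zeta>] conjI allI impI)
      fix x assume "\<forall>k<?n. \<zeta> k x = 0"
      then show "x = 0" by (rule l5)
    qed (fact l1 l2 l3 l4)+
  qed
  show ?thesis using that[OF eig \<epsilon>0 coords] .
qed

section \<open>Exponential sums seen through a persistent signal\<close>

text \<open>What a persistent signal retains on a single window, translated to start at 0 and stated
  with the gauge integral.\<close>

definition window_signals :: "real \<Rightarrow> real \<Rightarrow> (real \<Rightarrow> real) set" where
  "window_signals T \<mu> =
     {\<alpha>. \<alpha> integrable_on {0..T} \<and> (\<forall>s\<in>{0..T}. 0 \<le> \<alpha> s \<and> \<alpha> s \<le> 1) \<and> \<mu> \<le> integral {0..T} \<alpha>}"

lemma integrable_signal_scaleR:
  fixes g :: "real \<Rightarrow> 'a :: euclidean_space"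
  assumes "\<alpha> integrable_on {a..b}" "\<And>s. s \<in> {a..b} \<Longrightarrow> 0 \<le> \<alpha> s" "continuous_on {a..b} g"
  shows "(\<lambda>s. \<alpha> s *\<^sub>R g s) integrable_on {a..b}"
proof -
  have "(\<lambda>s. \<alpha> s *\<^sub>R g s) absolutely_integrable_on {a..b}"
  proof (rule absolutely_integrable_bounded_measurable_product[where h = "\<lambda>(u::'a) (c::real). c *\<^sub>R u"])
    show "bilinear (\<lambda>(u::'a) (c::real). c *\<^sub>R u)"
      by (simp add: bilinear_def linear_iff algebra_simps)
    show "g \<in> borel_measurable (lebesgue_on {a..b})"
      using assms(3) by (rule continuous_imp_measurable_on_sets_lebesgue) auto
    show "bounded (g ` {a..b})"
      using compact_continuous_image[OF assms(3)] by (simp add: compact_imp_bounded)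
    show "\<alpha> absolutely_integrable_on {a..b}"
      using assms(1,2) by (intro nonnegative_absolutely_integrable_1) auto
  qed auto
  then show ?thesis by (simp add: absolutely_integrable_on_def)
qed

lemma integrable_signal_mult:
  fixes g :: "real \<Rightarrow> real"
  assumes "\<alpha> integrable_on {a..b}" "\<And>s. s \<in> {a..b} \<Longrightarrow> 0 \<le> \<alpha> s" "continuous_on {a..b} g"
  shows "(\<lambda>s. \<alpha> s * g s) integrable_on {a..b}"
  using integrable_signal_scaleR[OF assms] by simp

text \<open>Differentiating and subtracting \<open>a\<close> times the sum eliminates the exponent
  \<open>a\<close>. The remaining sum over \<open>\<Lambda>\<close> has coefficients
  \<open>z l * (l - a)\<close>, in which the second factor is nonzero.\<close>

lemma exp_sum_eq_0_imp_coeffs_0: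
  fixes z :: "complex \<Rightarrow> complex"
  assumes "finite \<Lambda>" "\<And>s. (\<Sum>l\<in>\<Lambda>. z l * exp (l * s)) = 0" "l \<in> \<Lambda>"
  shows "z l = 0"
  using assms
proof (induction \<Lambda> arbitrary: z l rule: finite_induct)
  case (insert a \<Lambda>)
  have rest: "z l = 0" if "l \<in> \<Lambda>" for l
  proof -
    have "(\<Sum>l\<in>\<Lambda>. z l * (l - a) * exp (l * s)) = 0" for s
    proof -
      let ?f = "\<lambda>s. \<Sum>l\<in>insert a \<Lambda>. z l * exp (l * s)"
      have "(?f has_field_derivative (\<Sum>l\<in>insert a \<Lambda>. z l * (l * exp (l * s)))) (at s)"
        by (auto intro!: derivative_eq_intros sum.cong)
      moreover have "(?f has_field_derivative 0) (at s)"
        unfolding insert.prems(1) by (rule DERIV_const)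
      ultimately have "(\<Sum>l\<in>insert a \<Lambda>. z l * (l * exp (l * s))) = 0"
        by (rule DERIV_unique)
      then have "(\<Sum>l\<in>insert a \<Lambda>. z l * (l * exp (l * s))) - a * ?f s = 0"
        using insert.prems(1)[of s] by simp
      then show ?thesis
        using insert.hyps by (simp add: sum_distrib_left sum_subtractf algebra_simps)
    qed
    then have "z l * (l - a) = 0" by (rule insert.IH[OF _ that])
    then show ?thesis using that insert.hyps by auto
  qed
  then have "z a = 0" using insert.prems(1)[of 0] insert.hyps by simp
  then show ?case using rest insert.prems by auto
qed simp

text \<open>A nonconstant entire function has countably many zeros. A constant sum is treated apart:
  it is nonzero by the independence of the exponentials.\<close>

lemma negligible_exp_sum_zeros:
  fixes z :: "complex \<Rightarrow> complex"
  assumes "finite \<Lambda>" "l \<in> \<Lambda>" "z l \<noteq> 0"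
  shows "negligible {s::real. (\<Sum>l\<in>\<Lambda>. z l * exp (l * of_real s)) = 0}"
proof -
  let ?f = "\<lambda>s. \<Sum>l\<in>\<Lambda>. z l * exp (l * s)"
  have "countable {s. ?f s = 0}"
  proof (cases "?f constant_on UNIV")
    case True
    then obtain c where c: "\<And>s. ?f s = c" by (auto simp: constant_on_def)
    then have "c \<noteq> 0" using exp_sum_eq_0_imp_coeffs_0[OF assms(1) _ assms(2), of z] assms(3) by auto
    then show ?thesis by (simp add: c)
  next
    case False
    have "?f holomorphic_on UNIV" by (intro holomorphic_intros)
    then show ?thesis using holomorphic_countable_zeros[of ?f UNIV] False
      by (simp add: connected_UNIV)
  qed
  then have "countable (complex_of_real -` {s. ?f s = 0})"
    by (rule countable_image_inj_on[OF countable_subset[OF image_vimage_subset]])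
      (simp add: inj_on_def)
  then show ?thesis
    by (simp add: vimage_def negligible_iff_null_sets null_sets_completionI countable_imp_null_set_lborel)
qed

text \<open>
  By dominated convergence \<open>\<integral>1 / (1 + m \<bar>f\<bar>\<^sup>2) \<rightarrow> 0\<close> as \<open>m \<rightarrow> \<infinity>\<close>; integrate
  \<open>\<alpha> \<le> 1 / (1 + m \<bar>f\<bar>\<^sup>2) + m \<alpha> \<bar>f\<bar>\<^sup>2\<close> for one large \<open>m\<close>.
\<close>
lemma window_signal_detects:
  fixes f :: "real \<Rightarrow> complex"
  assumes "continuous_on {0..T} f" "negligible {s\<in>{0..T}. f s = 0}" "\<mu> > 0"
  obtains \<delta> where "\<delta> > 0"
    "\<And>\<alpha>. \<alpha> \<in> window_signals T \<mu> \<Longrightarrow> \<delta> \<le> integral {0..T} (\<lambda>s. \<alpha> s * (cmod (f s))\<^sup>2)"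
proof -
  define g where "g m s = 1 / (1 + real m * (cmod (f s))\<^sup>2)" for m s
  have pos: "1 + real m * (cmod (f s))\<^sup>2 > 0" for m s
    by (rule add_pos_nonneg) auto
  have g_cont: "continuous_on {0..T} (g m)" for m
    unfolding g_def using pos[of m] by (auto intro!: continuous_intros assms(1)) (metis less_irrefl)
  have "(\<lambda>m. integral {0..T} (g m)) \<longlonglongrightarrow> integral {0..T} (\<lambda>s. if f s = 0 then 1 else 0)"
  proof (rule dominated_convergence(2))
    show "g m integrable_on {0..T}" for m
      using g_cont by (rule integrable_continuous_real)
    show "(\<lambda>_. 1::real) integrable_on {0..T}" by (rule integrable_const_ivl)
    show "norm (g m s) \<le> 1" for m s
      using pos[of m s] by (simp add: g_def)
    show "(\<lambda>m. g m s) \<longlonglongrightarrow> (if f s = 0 then 1 else 0)" for s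
    proof (cases "f s = 0")
      case False
      then have "0 < (cmod (f s))\<^sup>2" by simp
      then have "(\<lambda>m. g m s) \<longlonglongrightarrow> 0" unfolding g_def by real_asymp
      then show ?thesis using False by simp
    qed (simp add: g_def)
  qed
  also have "integral {0..T} (\<lambda>s. if f s = 0 then 1 else 0 :: real) = integral {0..T} (\<lambda>_. 0)"
    by (rule integral_spike[OF assms(2)]) auto
  finally have "(\<lambda>m. integral {0..T} (g m)) \<longlonglongrightarrow> 0" by simp
  then have "\<forall>\<^sub>F m in sequentially. integral {0..T} (g m) < \<mu> / 2"
    using assms(3) by (intro order_tendstoD) auto
  then obtain m where m: "integral {0..T} (g m) < \<mu> / 2" "m > 0"
    by (metis (no_types, lifting) eventually_gt_at_top eventually_conj eventually_sequentially order_refl)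
  \<comment> \<open>The integral of \<open>g m\<close> takes less than half of \<open>\<mu>\<close>,
    so at least \<open>\<mu> / 2\<close> is left for the term with factor \<open>m\<close>. The
    constant does not depend on \<open>\<alpha>\<close>.\<close>
  have "\<mu> / (2 * real m) \<le> integral {0..T} (\<lambda>s. \<alpha> s * (cmod (f s))\<^sup>2)"
    if \<alpha>: "\<alpha> \<in> window_signals T \<mu>" for \<alpha>
  proof -
    have int_f: "(\<lambda>s. \<alpha> s * (cmod (f s))\<^sup>2) integrable_on {0..T}"
      using \<alpha> by (intro integrable_signal_mult continuous_intros assms(1)) (auto simp: window_signals_def)
    have "\<mu> \<le> integral {0..T} \<alpha>" using \<alpha> by (simp add: window_signals_def)
    also have "\<dots> \<le> integral {0..T} (\<lambda>s. g m s + real m * (\<alpha> s * (cmod (f s))\<^sup>2))"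
    proof (rule integral_le)
      show "\<alpha> integrable_on {0..T}" using \<alpha> by (simp add: window_signals_def)
      show "(\<lambda>s. g m s + real m * (\<alpha> s * (cmod (f s))\<^sup>2)) integrable_on {0..T}"
        by (intro integrable_add integrable_continuous_real g_cont integrable_on_mult_right int_f)
      fix s assume s: "s \<in> {0..T}"
      let ?u = "real m * (cmod (f s))\<^sup>2"
      have a: "0 \<le> \<alpha> s" "\<alpha> s \<le> 1" using \<alpha> s by (auto simp: window_signals_def)
      have "1 \<le> g m s + ?u"
      proof -
        have "(1 - ?u) * (1 + ?u) \<le> 1" by (simp add: algebra_simps)
        then show ?thesis using pos[of m s] by (simp add: g_def field_simps)
      qed
      then have "\<alpha> s \<le> \<alpha> s * (g m s + ?u)" using a mult_left_mono[of 1 "g m s + ?u" "\<alpha> s"] by simp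
      also have "\<dots> \<le> g m s + \<alpha> s * ?u"
        using mult_left_le_one_le[of "g m s" "\<alpha> s"] a pos[of m s]
        by (simp add: distrib_left g_def less_imp_le)
      finally show "\<alpha> s \<le> g m s + real m * (\<alpha> s * (cmod (f s))\<^sup>2)" by (simp add: mult_ac)
    qed
    also have "\<dots> = integral {0..T} (g m) + real m * integral {0..T} (\<lambda>s. \<alpha> s * (cmod (f s))\<^sup>2)"
      by (subst integral_add) (auto intro!: integrable_continuous_real g_cont integrable_on_mult_right int_f)
    finally show ?thesis using m by (simp add: field_simps)
  qed
  then show ?thesis using that[of "\<mu> / (2 * real m)"] m assms(3) by simp
qed

text \<open>Coefficient vectors are functions on all of the complex numbers that vanish off
  \<open>\<Lambda>\<close>. They lie in a product of unit discs and singletons, compact by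
  Tychonoff's theorem, and the norm condition is closed because it involves finitely many
  coordinates.\<close>

lemma compact_unit_coeffs:
  assumes "finite \<Lambda>"
  shows "compact {z :: complex \<Rightarrow> complex. (\<forall>l. l \<notin> \<Lambda> \<longrightarrow> z l = 0) \<and> (\<Sum>l\<in>\<Lambda>. cmod (z l)) = 1}"
    (is "compact ?S")
proof -
  let ?B = "PiE UNIV (\<lambda>l. if l \<in> \<Lambda> then cball 0 1 else {0::complex})"
  have "compactin (product_topology (\<lambda>_. euclidean) UNIV) ?B"
    by (subst compactin_PiE) auto
  then have "compact ?B" by (simp add: euclidean_product_topology)
  moreover have "closed {z :: complex \<Rightarrow> complex. (\<Sum>l\<in>\<Lambda>. cmod (z l)) = 1}"
    by (intro closed_Collect_eq continuous_intros continuous_on_product_coordinates)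
  ultimately have "compact (?B \<inter> {z. (\<Sum>l\<in>\<Lambda>. cmod (z l)) = 1})" by (rule compact_Int_closed)
  moreover have "?B \<inter> {z. (\<Sum>l\<in>\<Lambda>. cmod (z l)) = 1} = ?S"
  proof (intro equalityI subsetI)
    fix z assume z: "z \<in> ?S"
    have "cmod (z l) \<le> 1" if "l \<in> \<Lambda>" for l
      using z member_le_sum[OF that, of "\<lambda>l. cmod (z l)"] assms by auto
    then show "z \<in> ?B \<inter> {z. (\<Sum>l\<in>\<Lambda>. cmod (z l)) = 1}" using z by auto
  qed (auto simp: PiE_iff split: if_splits)
  ultimately show ?thesis by simp
qed

lemma exp_sum_bound:
  fixes z :: "complex \<Rightarrow> complex"
  assumes "finite \<Lambda>" "0 \<le> s" "\<And>l. l \<in> \<Lambda> \<Longrightarrow> Re l \<le> 0"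
  shows "cmod (\<Sum>l\<in>\<Lambda>. z l * exp (l * of_real s)) \<le> (\<Sum>l\<in>\<Lambda>. cmod (z l))"
proof -
  have "cmod (\<Sum>l\<in>\<Lambda>. z l * exp (l * of_real s)) \<le> (\<Sum>l\<in>\<Lambda>. cmod (z l * exp (l * of_real s)))"
    by (rule norm_sum)
  also have "\<dots> \<le> (\<Sum>l\<in>\<Lambda>. cmod (z l))"
    using assms by (intro sum_mono) (auto simp: norm_mult mult_left_le mult_nonpos_nonneg)
  finally show ?thesis .
qed

text \<open>Each unit coefficient vector \<open>w\<close> has a lower bound \<open>D w\<close> valid
  for all signals. Since \<open>0 \<le> \<alpha> \<le> 1\<close>, part of it survives on a
  neighbourhood of \<open>w\<close> that is independent of the signal, and finitely many
  neighbourhoods suffice. Compactness is used for the coefficients only; no topology on signals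
  enters.\<close>

lemma exp_sum_persistence_unit:
  assumes "finite \<Lambda>" "\<And>l. l \<in> \<Lambda> \<Longrightarrow> Re l \<le> 0" "T > 0" "\<mu> > 0"
  obtains \<delta> where "\<delta> > 0"
    "\<And>\<alpha> z. \<alpha> \<in> window_signals T \<mu> \<Longrightarrow> (\<forall>l. l \<notin> \<Lambda> \<longrightarrow> z l = 0) \<Longrightarrow> (\<Sum>l\<in>\<Lambda>. cmod (z l)) = 1 \<Longrightarrow>
      \<delta> \<le> integral {0..T} (\<lambda>s. \<alpha> s * (cmod (\<Sum>l\<in>\<Lambda>. z l * exp (l * of_real s)))\<^sup>2)"
proof -
  define f :: "(complex \<Rightarrow> complex) \<Rightarrow> real \<Rightarrow> complex"
    where "f z s = (\<Sum>l\<in>\<Lambda>. z l * exp (l * of_real s))" for z s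
  let ?S = "{z :: complex \<Rightarrow> complex. (\<forall>l. l \<notin> \<Lambda> \<longrightarrow> z l = 0) \<and> (\<Sum>l\<in>\<Lambda>. cmod (z l)) = 1}"
  let ?I = "\<lambda>\<alpha> z. integral {0..T} (\<lambda>s. \<alpha> s * (cmod (f z s))\<^sup>2)"
  have f_cont: "continuous_on {0..T} (f z)" for z
    unfolding f_def by (intro continuous_intros)
  have int_f: "(\<lambda>s. \<alpha> s * (cmod (f z s))\<^sup>2) integrable_on {0..T}" if "\<alpha> \<in> window_signals T \<mu>" for \<alpha> z
    using that by (intro integrable_signal_mult continuous_intros f_cont) (auto simp: window_signals_def)
  have "\<exists>\<delta>. \<delta> > 0 \<and> (\<forall>\<alpha>\<in>window_signals T \<mu>. \<delta> \<le> ?I \<alpha> w)" if w: "w \<in> ?S" for w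
  proof -
    have "(\<Sum>l\<in>\<Lambda>. cmod (w l)) \<noteq> 0" using w by simp
    then obtain l where l: "l \<in> \<Lambda>" "w l \<noteq> 0" by (metis norm_zero sum.neutral)
    have "negligible {s\<in>{0..T}. f w s = 0}"
      by (rule negligible_subset[OF negligible_exp_sum_zeros[of \<Lambda> l w]]) (use l assms in \<open>auto simp: f_def\<close>)
    then obtain \<delta> where "\<delta> > 0" "\<And>\<alpha>. \<alpha> \<in> window_signals T \<mu> \<Longrightarrow> \<delta> \<le> ?I \<alpha> w"
      using window_signal_detects[OF f_cont _ assms(4)] by blast
    then show ?thesis by (intro exI[of _ \<delta>] conjI ballI)
  qed
  then have "\<exists>D. \<forall>w\<in>?S. D w > 0 \<and> (\<forall>\<alpha>\<in>window_signals T \<mu>. D w \<le> ?I \<alpha> w)"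
    by (intro bchoice ballI)
  then obtain D where D_all: "\<forall>w\<in>?S. D w > 0 \<and> (\<forall>\<alpha>\<in>window_signals T \<mu>. D w \<le> ?I \<alpha> w)" ..
  have D: "D w > 0" "\<And>\<alpha>. \<alpha> \<in> window_signals T \<mu> \<Longrightarrow> D w \<le> ?I \<alpha> w" if "w \<in> ?S" for w
    using bspec[OF D_all that] by auto
  \<comment> \<open>The radius is such that passing from \<open>w\<close> to \<open>z\<close> costs
    at most \<open>D w / 2\<close>; after the factor 2 from squaring a sum, \<open>D w / 4\<close>
    remains.\<close>
  define U where "U w = {z. T * (\<Sum>l\<in>\<Lambda>. cmod (z l - w l))\<^sup>2 < D w / 4}" for w
  have cover: "?S \<subseteq> (\<Union>w\<in>?S. U w)" using D(1) by (auto simp: U_def)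
  have U_open: "open (U w)" for w
    unfolding U_def by (intro open_Collect_less continuous_intros continuous_on_product_coordinates)
  obtain W where W: "W \<subseteq> ?S" "finite W" "?S \<subseteq> (\<Union>w\<in>W. U w)"
    by (rule compactE_image[OF compact_unit_coeffs[OF assms(1)] U_open cover]) (rule that)
  \<comment> \<open>The entry 1 serves the case of empty \<open>\<Lambda>\<close>, in which
    \<open>W\<close> is empty.\<close>
  define \<delta> where "\<delta> = Min (insert 1 ((\<lambda>w. D w / 4) ` W))"
  have "\<delta> > 0" unfolding \<delta>_def using W(1,2) D(1) by (simp add: subset_iff)
  moreover have "\<delta> \<le> ?I \<alpha> z" if \<alpha>: "\<alpha> \<in> window_signals T \<mu>" and z: "z \<in> ?S" for \<alpha> z
  proof -
    obtain w where w: "w \<in> W" "z \<in> U w" using subsetD[OF W(3) z] by (elim UN_E)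
    let ?r = "\<Sum>l\<in>\<Lambda>. cmod (z l - w l)"
    have "D w \<le> ?I \<alpha> w" by (rule D(2)[OF subsetD[OF W(1) w(1)] \<alpha>])
    also have "\<dots> \<le> integral {0..T} (\<lambda>s. 2 * (\<alpha> s * (cmod (f z s))\<^sup>2) + 2 * ?r\<^sup>2)"
    proof (rule integral_le)
      fix s assume s: "s \<in> {0..T}"
      have a: "0 \<le> \<alpha> s" "\<alpha> s \<le> 1" using \<alpha> s by (auto simp: window_signals_def)
      have "cmod (f w s - f z s) \<le> ?r"
        using exp_sum_bound[OF assms(1), of s "\<lambda>l. w l - z l"] s assms(2)
        by (simp add: f_def sum_subtractf left_diff_distrib norm_minus_commute)
      moreover have "cmod (f w s) \<le> cmod (f z s) + cmod (f w s - f z s)"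
        by (metis add.commute norm_triangle_sub)
      ultimately have "cmod (f w s) \<le> cmod (f z s) + ?r" by linarith
      then have "(cmod (f w s))\<^sup>2 \<le> (cmod (f z s) + ?r)\<^sup>2" by (rule power_mono) simp
      also have "\<dots> \<le> 2 * (cmod (f z s))\<^sup>2 + 2 * ?r\<^sup>2" 
        using sum_squares_bound[of "cmod (f z s)" ?r] by (simp add: power2_sum)
      finally have "\<alpha> s * (cmod (f w s))\<^sup>2 \<le> \<alpha> s * (2 * (cmod (f z s))\<^sup>2 + 2 * ?r\<^sup>2)"
        using a by (intro mult_left_mono)
      also have "\<dots> \<le> 2 * (\<alpha> s * (cmod (f z s))\<^sup>2) + 2 * ?r\<^sup>2"
        using a mult_left_le_one_le[of "2 * ?r\<^sup>2" "\<alpha> s"] by (simp add: algebra_simps)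
      finally show "\<alpha> s * (cmod (f w s))\<^sup>2 \<le> 2 * (\<alpha> s * (cmod (f z s))\<^sup>2) + 2 * ?r\<^sup>2" .
    qed (intro integrable_add integrable_on_mult_right int_f[OF \<alpha>] integrable_const_ivl)+
    also have "\<dots> = 2 * ?I \<alpha> z + 2 * (T * ?r\<^sup>2)"
      using assms(3) by (subst integral_add) (auto intro!: integrable_on_mult_right int_f[OF \<alpha>])
    also have "\<dots> \<le> 2 * ?I \<alpha> z + D w / 2" using w(2) by (simp add: U_def)
    finally have "D w / 4 \<le> ?I \<alpha> z" by simp
    moreover have "\<delta> \<le> D w / 4" unfolding \<delta>_def using w(1) W(2) by (intro Min_le) auto
    ultimately show ?thesis by linarith
  qed
  ultimately show ?thesis using that[of \<delta>] unfolding f_def by simp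
qed

text \<open>Equal exponents are merged first, since independence needs distinct ones. With
  \<open>N\<close> the sum of moduli of the merged coefficients, the plain integral is at most
  \<open>T * N\<^sup>2\<close>, while scaling the unit case bounds the weighted one below by
  \<open>\<delta> * N\<^sup>2\<close>; hence the ratio \<open>\<delta> / T\<close>. Merged
  coefficients may cancel, which is the case \<open>N = 0\<close>.\<close>

lemma exp_sum_persistence:
  fixes \<rho> :: "nat \<Rightarrow> complex"
  assumes "\<And>k. k < n \<Longrightarrow> Re (\<rho> k) \<le> 0" "T > 0" "\<mu> > 0"
  shows "\<exists>\<delta>>0. \<forall>\<alpha>\<in>window_signals T \<mu>. \<forall>z.
      \<delta> * integral {0..T} (\<lambda>s. (cmod (\<Sum>k<n. z k * exp (\<rho> k * of_real s)))\<^sup>2) \<le>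
      integral {0..T} (\<lambda>s. \<alpha> s * (cmod (\<Sum>k<n. z k * exp (\<rho> k * of_real s)))\<^sup>2)"
proof -
  define \<Lambda> where "\<Lambda> = \<rho> ` {..<n}"
  have fin: "finite \<Lambda>" and neg: "\<And>l. l \<in> \<Lambda> \<Longrightarrow> Re l \<le> 0" using assms(1) by (auto simp: \<Lambda>_def)
  obtain \<delta> where \<delta>: "\<delta> > 0" and unit: "\<And>\<alpha> z. \<alpha> \<in> window_signals T \<mu> \<Longrightarrow>
      (\<forall>l. l \<notin> \<Lambda> \<longrightarrow> z l = 0) \<Longrightarrow> (\<Sum>l\<in>\<Lambda>. cmod (z l)) = 1 \<Longrightarrow>
      \<delta> \<le> integral {0..T} (\<lambda>s. \<alpha> s * (cmod (\<Sum>l\<in>\<Lambda>. z l * exp (l * of_real s)))\<^sup>2)"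
    using exp_sum_persistence_unit[OF fin neg assms(2,3)] by blast
  have "\<delta> / T * integral {0..T} (\<lambda>s. (cmod (\<Sum>k<n. z k * exp (\<rho> k * of_real s)))\<^sup>2) \<le>
      integral {0..T} (\<lambda>s. \<alpha> s * (cmod (\<Sum>k<n. z k * exp (\<rho> k * of_real s)))\<^sup>2)"
    if \<alpha>: "\<alpha> \<in> window_signals T \<mu>" for \<alpha> z
  proof -
    define y where "y l = (\<Sum>k\<in>{k. k < n \<and> \<rho> k = l}. z k)" for l
    define N where "N = (\<Sum>l\<in>\<Lambda>. cmod (y l))"
    define f where "f s = (\<Sum>l\<in>\<Lambda>. y l * exp (l * of_real s))" for s
    have f_eq: "(\<Sum>k<n. z k * exp (\<rho> k * of_real s)) = f s" for s
    proof -
      have "(\<Sum>k<n. z k * exp (\<rho> k * of_real s)) =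
          (\<Sum>l\<in>\<Lambda>. \<Sum>k | k \<in> {..<n} \<and> \<rho> k = l. z k * exp (\<rho> k * of_real s))"
        unfolding \<Lambda>_def by (rule sum.image_gen) simp
      also have "\<dots> = f s"
        unfolding f_def y_def sum_distrib_right by (intro sum.cong) auto
      finally show ?thesis .
    qed
    have y0: "y l = 0" if "l \<notin> \<Lambda>" for l
      using that unfolding y_def \<Lambda>_def by (intro sum.neutral) auto
    have f_cont: "continuous_on {0..T} f" unfolding f_def by (intro continuous_intros)
    have "integral {0..T} (\<lambda>s. (cmod (f s))\<^sup>2) \<le> integral {0..T} (\<lambda>_. N\<^sup>2)"
    proof (rule integral_le)
      fix s assume "s \<in> {0..T}"
      then have "cmod (f s) \<le> N"
        unfolding f_def N_def by (intro exp_sum_bound[OF fin _ neg]) auto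
      then show "(cmod (f s))\<^sup>2 \<le> N\<^sup>2" by (rule power_mono) simp
    qed (auto intro!: integrable_continuous_real continuous_intros f_cont)
    also have "\<dots> = T * N\<^sup>2" using assms(2) by simp
    finally have 1: "\<delta> / T * integral {0..T} (\<lambda>s. (cmod (f s))\<^sup>2) \<le> \<delta> * N\<^sup>2"
      using \<delta> assms(2) by (simp add: field_simps)
    have 2: "\<delta> * N\<^sup>2 \<le> integral {0..T} (\<lambda>s. \<alpha> s * (cmod (f s))\<^sup>2)"
    proof (cases "N = 0")
      case True
      have "0 \<le> integral {0..T} (\<lambda>s. \<alpha> s * (cmod (f s))\<^sup>2)"
        using \<alpha> by (intro integral_nonneg integrable_signal_mult continuous_intros f_cont)
          (auto simp: window_signals_def)
      then show ?thesis using True by simp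
    next
      case False
      then have N: "N > 0" unfolding N_def by (simp add: sum_nonneg less_le)
      let ?y = "\<lambda>l. y l / of_real N"
      have "(\<Sum>l\<in>\<Lambda>. cmod (?y l)) = N / N"
        using N by (simp add: norm_divide N_def[symmetric] flip: sum_divide_distrib)
      then have "\<delta> \<le> integral {0..T} (\<lambda>s. \<alpha> s * (cmod (\<Sum>l\<in>\<Lambda>. ?y l * exp (l * of_real s)))\<^sup>2)"
        using N y0 by (intro unit[OF \<alpha>]) auto
      also have "(\<lambda>s. \<alpha> s * (cmod (\<Sum>l\<in>\<Lambda>. ?y l * exp (l * of_real s)))\<^sup>2) =
          (\<lambda>s. inverse (N\<^sup>2) * (\<alpha> s * (cmod (f s))\<^sup>2))"
      proof
        fix s
        have "(\<Sum>l\<in>\<Lambda>. ?y l * exp (l * of_real s)) = f s / of_real N"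
          by (simp add: f_def sum_divide_distrib)
        then show "\<alpha> s * (cmod (\<Sum>l\<in>\<Lambda>. ?y l * exp (l * of_real s)))\<^sup>2 =
            inverse (N\<^sup>2) * (\<alpha> s * (cmod (f s))\<^sup>2)"
          by (simp add: norm_divide power_divide field_simps)
      qed
      finally have "\<delta> \<le> inverse (N\<^sup>2) * integral {0..T} (\<lambda>s. \<alpha> s * (cmod (f s))\<^sup>2)" by simp
      then show ?thesis using N by (simp add: field_simps)
    qed
    show ?thesis unfolding f_eq using 1 2 by linarith
  qed
  then show ?thesis using \<delta> assms(2) by (intro exI[of _ "\<delta> / T"]) simp
qed

section \<open>Contraction over one window\<close>

lemma has_integral_increment:
  fixes f :: "real \<Rightarrow> 'a :: euclidean_space"
  assumes "(f has_integral I) {t..r}" "(f has_integral J) {t..s}" "t \<le> r" "r \<le> s"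
  shows "(f has_integral (J - I)) {r..s}"
proof -
  have "f integrable_on {r..s}"
    by (rule integrable_on_subinterval[OF has_integral_integrable[OF assms(2)]]) (use assms in auto)
  then have "(f has_integral integral {r..s} f) {r..s}" by (rule integrable_integral)
  moreover from this have "(f has_integral I + integral {r..s} f) {t..s}"
    by (rule has_integral_combine[OF assms(3,4,1)])
  then have "I + integral {r..s} f = J" using assms(2) by (rule has_integral_unique)
  then have "integral {r..s} f = J - I" by (simp add: algebra_simps)
  ultimately show ?thesis by simp
qed

text \<open>The difference quotients are at most of order \<open>s - r\<close>, so the derivative is
  zero throughout the interval.\<close>

lemma quadratic_modulus_imp_const:
  fixes D :: "real \<Rightarrow> real"
  assumes "a \<le> b" "\<And>r s. a \<le> r \<Longrightarrow> r \<le> s \<Longrightarrow> s \<le> b \<Longrightarrow> \<bar>D s - D r\<bar> \<le> C * (s - r)\<^sup>2"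
  shows "D b = D a"
proof -
  have *: "\<bar>D s - D r\<bar> \<le> C * (s - r)\<^sup>2" if "r \<in> {a..b}" "s \<in> {a..b}" for r s
    using assms(2)[of r s] assms(2)[of s r] that by (cases "r \<le> s") (auto simp: power2_commute abs_minus_commute)
  have "(D has_derivative (\<lambda>_. 0)) (at r within {a..b})" if r: "r \<in> {a..b}" for r
    unfolding has_derivative_within
  proof (intro conjI)
    show "((\<lambda>s. (1 / norm (s - r)) *\<^sub>R (D s - (D r + 0))) \<longlongrightarrow> 0) (at r within {a..b})"
    proof (rule Lim_null_comparison)
      show "\<forall>\<^sub>F s in at r within {a..b}. norm ((1 / norm (s - r)) *\<^sub>R (D s - (D r + 0))) \<le> \<bar>C\<bar> * \<bar>s - r\<bar>"
        unfolding eventually_at_filter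
      proof (intro always_eventually allI impI)
        fix s assume s: "s \<noteq> r" "s \<in> {a..b}"
        have "\<bar>D s - D r\<bar> \<le> C * (s - r)\<^sup>2" using *[OF r s(2)] .
        also have "\<dots> \<le> \<bar>C\<bar> * (\<bar>s - r\<bar> * \<bar>s - r\<bar>)"
          by (simp add: power2_eq_square mult_right_mono)
        finally show "norm ((1 / norm (s - r)) *\<^sub>R (D s - (D r + 0))) \<le> \<bar>C\<bar> * \<bar>s - r\<bar>"
          using s(1) by (simp add: field_simps)
      qed
      show "((\<lambda>s. \<bar>C\<bar> * \<bar>s - r\<bar>) \<longlongrightarrow> 0) (at r within {a..b})"
        by (auto intro!: tendsto_eq_intros)
    qed
  qed (rule bounded_linear_zero)
  then obtain d where "\<And>r. r \<in> {a..b} \<Longrightarrow> D r = d"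
    using has_derivative_zero_constant[of "{a..b}" D] by auto
  then show ?thesis using assms(1) by simp
qed

text \<open>
  The chain rule for the squared norm of an indefinite integral of a merely measurable function:
  over \<open>{r..s}\<close> both sides agree up to \<open>O((s - r)\<^sup>2)\<close>, so their difference has derivative zero.
\<close>
lemma has_integral_norm_square:
  fixes F f :: "real \<Rightarrow> 'a :: euclidean_space"
  assumes "a \<le> b"
    and F: "\<And>s. s \<in> {a..b} \<Longrightarrow> (f has_integral (F s - F a)) {a..s}"
    and B: "\<And>s. s \<in> {a..b} \<Longrightarrow> norm (f s) \<le> B"
  shows "((\<lambda>s. 2 * (F s \<bullet> f s)) has_integral ((norm (F b))\<^sup>2 - (norm (F a))\<^sup>2)) {a..b}"
proof -
  have B0: "0 \<le> B" by (rule order_trans[OF norm_ge_zero B[of a]]) (use assms(1) in simp)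
  have incr: "(f has_integral (F s - F r)) {r..s}" if "a \<le> r" "r \<le> s" "s \<le> b" for r s
    using has_integral_increment[OF F[of r] F[of s]] that by simp
  have lip: "norm (F s - F r) \<le> B * (s - r)" if "a \<le> r" "r \<le> s" "s \<le> b" for r s
    using has_integral_bound_real[OF B0 finite.emptyI incr[OF that]] B that by auto
  have lip': "norm (F s - F r) \<le> B * \<bar>s - r\<bar>" if "r \<in> {a..b}" "s \<in> {a..b}" for r s
    using lip[of r s] lip[of s r] that by (cases "r \<le> s") (auto simp: norm_minus_commute)
  have F_cont: "continuous_on {a..b} F"
    using lip' B0 by (intro lipschitz_on_continuous_on[of B] lipschitz_onI) (auto simp: dist_norm)
  have f_int: "f integrable_on {a..b}" using F[of b] assms(1) by auto
  have f_abs: "f absolutely_integrable_on {a..b}"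
    by (rule absolutely_integrable_integrable_bound[OF B f_int integrable_const_ivl])
  have "(\<lambda>s. F s \<bullet> f s) absolutely_integrable_on {a..b}"
  proof (rule absolutely_integrable_bounded_measurable_product[where h = "(\<bullet>)"])
    show "bilinear ((\<bullet>) :: 'a \<Rightarrow> 'a \<Rightarrow> real)"
      by (simp add: bilinear_def linear_iff inner_simps)
    show "F \<in> borel_measurable (lebesgue_on {a..b})"
      using F_cont by (rule continuous_imp_measurable_on_sets_lebesgue) auto
    show "bounded (F ` {a..b})"
      using compact_continuous_image[OF F_cont] by (simp add: compact_imp_bounded)
  qed (use f_abs in auto)
  then have "(\<lambda>s. F s \<bullet> f s) integrable_on {a..b}" by (simp add: absolutely_integrable_on_def)
  then have G_int: "(\<lambda>s. 2 * (F s \<bullet> f s)) integrable_on {a..b}" by (rule integrable_on_mult_right)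
  let ?G = "\<lambda>s. 2 * (F s \<bullet> f s)"
  let ?D = "\<lambda>s. (norm (F s))\<^sup>2 - integral {a..s} ?G"
  have "?D b = ?D a"
  proof (rule quadratic_modulus_imp_const[OF assms(1)])
    fix r s assume rs: "a \<le> r" "r \<le> s" "s \<le> b"
    have G_rs: "?G integrable_on {r..s}"
      using G_int by (rule integrable_on_subinterval) (use rs in auto)
    have "?G integrable_on {a..s}"
      using G_int by (rule integrable_on_subinterval) (use rs in auto)
    then have split: "integral {a..s} ?G = integral {a..r} ?G + integral {r..s} ?G"
      using rs by (intro Henstock_Kurzweil_Integration.integral_combine[symmetric]) auto
    \<comment> \<open>The increment of the square is the integral of the fixed vector
      \<open>F s + F r\<close> against \<open>f\<close>. The error integrand is then
      \<open>(F s + F r - 2 F \<tau>) \<bullet> f \<tau>\<close>, which the Lipschitz bound makes of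
      order \<open>s - r\<close>.\<close>
    have square: "(norm (F s))\<^sup>2 - (norm (F r))\<^sup>2 = (F s + F r) \<bullet> (F s - F r)"
      by (simp add: power2_norm_eq_inner inner_simps inner_commute)
    have "((\<lambda>\<tau>. (F s + F r) \<bullet> f \<tau> - ?G \<tau>) has_integral
        ((F s + F r) \<bullet> (F s - F r) - integral {r..s} ?G)) {r..s}"
      using has_integral_linear[OF incr[OF rs] bounded_linear_inner_right[of "F s + F r"]]
      by (intro has_integral_diff integrable_integral[OF G_rs]) (simp add: o_def)
    moreover have "?D s - ?D r = (F s + F r) \<bullet> (F s - F r) - integral {r..s} ?G"
      using split square by linarith
    ultimately have D: "((\<lambda>\<tau>. (F s + F r) \<bullet> f \<tau> - ?G \<tau>) has_integral (?D s - ?D r)) {r..s}"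
      by (simp only:)
    have bnd: "norm ((F s + F r) \<bullet> f \<tau> - ?G \<tau>) \<le> 2 * B\<^sup>2 * (s - r)" if \<tau>: "\<tau> \<in> {r..s}" for \<tau>
    proof -
      have "(F s + F r) \<bullet> f \<tau> - ?G \<tau> = ((F s - F \<tau>) + (F r - F \<tau>)) \<bullet> f \<tau>"
        by (simp add: inner_simps)
      also have "norm \<dots> \<le> norm ((F s - F \<tau>) + (F r - F \<tau>)) * norm (f \<tau>)"
        by (simp add: Cauchy_Schwarz_ineq2)
      also have "\<dots> \<le> (2 * (B * (s - r))) * B"
      proof (rule mult_mono)
        have "B * \<bar>s - \<tau>\<bar> \<le> B * (s - r)" "B * \<bar>r - \<tau>\<bar> \<le> B * (s - r)"
          using \<tau> B0 by (auto intro: mult_left_mono)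
        then have "norm (F s - F \<tau>) \<le> B * (s - r)" "norm (F r - F \<tau>) \<le> B * (s - r)"
          using lip'[of \<tau> s] lip'[of \<tau> r] \<tau> rs by auto
        then show "norm ((F s - F \<tau>) + (F r - F \<tau>)) \<le> 2 * (B * (s - r))"
          using norm_triangle_ineq[of "F s - F \<tau>" "F r - F \<tau>"] by linarith
        show "norm (f \<tau>) \<le> B" using B \<tau> rs by auto
      qed (use B0 rs in auto)
      finally show ?thesis by (simp add: power2_eq_square mult_ac)
    qed
    have "norm (?D s - ?D r) \<le> 2 * B\<^sup>2 * (s - r) * measure lborel {r..s}"
      by (rule has_integral_bound_real[OF _ finite.emptyI D]) (use bnd rs in auto)
    then show "\<bar>?D s - ?D r\<bar> \<le> 2 * B\<^sup>2 * (s - r)\<^sup>2"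
      using rs by (simp add: power2_eq_square mult_ac)
  qed
  then have "integral {a..b} ?G = (norm (F b))\<^sup>2 - (norm (F a))\<^sup>2" by simp
  then show ?thesis using integrable_integral[OF G_int] by simp
qed

text \<open>In the square of the sum every unordered pair of distinct indices contributes twice.
  This identity turns the triangular coupling into the dissipation \<open>- \<epsilon> V\<close>, at
  the price of a term in \<open>Y\<^sup>2\<close>.\<close>

lemma sum_inner_partial_sums:
  fixes z :: "nat \<Rightarrow> 'a :: real_inner"
  shows "2 * (\<Sum>k<n. z k \<bullet> (\<Sum>j<k. z j)) = (norm (\<Sum>k<n. z k))\<^sup>2 - (\<Sum>k<n. (norm (z k))\<^sup>2)"
  by (induction n) (auto simp: power2_norm_eq_inner inner_simps inner_commute algebra_simps)

text \<open>One window of a closed-loop trajectory, seen only through its cascade coordinates as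
  functions of time. The condition \<open>small\<close> keeps \<open>V\<close> from more than
  doubling within the window.\<close>

locale modal_window =
  fixes n :: nat and \<rho> :: "nat \<Rightarrow> complex" and \<epsilon> c t T :: real
    and \<alpha> :: "real \<Rightarrow> real" and \<zeta> :: "nat \<Rightarrow> real \<Rightarrow> complex"
  assumes T: "T > 0" and \<epsilon>: "\<epsilon> > 0" and c: "c \<ge> 0" and small: "\<epsilon> * n * T \<le> 1 / 2"
    and re_\<rho>: "\<And>k. k < n \<Longrightarrow> Re (\<rho> k) \<le> 0"
    and \<alpha>_int: "\<alpha> integrable_on {t..t+T}"
    and \<alpha>_range: "\<And>s. s \<in> {t..t+T} \<Longrightarrow> 0 \<le> \<alpha> s \<and> \<alpha> s \<le> 1"
    and \<zeta>_cont: "\<And>k. k < n \<Longrightarrow> continuous_on {t..t+T} (\<zeta> k)"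
    and sum_real: "\<And>s. s \<in> {t..t+T} \<Longrightarrow> Im (\<Sum>k<n. \<zeta> k s) = 0"
    and \<zeta>_ode: "\<And>k s. k < n \<Longrightarrow> s \<in> {t..t+T} \<Longrightarrow>
      ((\<lambda>r. \<rho> k * \<zeta> k r + of_real \<epsilon> * ((\<Sum>j<k. \<zeta> j r) - of_real (c * \<alpha> r) * (\<Sum>j<n. \<zeta> j r)))
        has_integral (\<zeta> k s - \<zeta> k t)) {t..s}"
begin

definition V :: "real \<Rightarrow> real" where "V s = (\<Sum>k<n. (cmod (\<zeta> k s))\<^sup>2)"

definition Y :: "real \<Rightarrow> real" where "Y s = Re (\<Sum>k<n. \<zeta> k s)"

definition forcing :: "nat \<Rightarrow> real \<Rightarrow> complex" where
  "forcing k s = of_real \<epsilon> * ((\<Sum>j<k. \<zeta> j s) - of_real (c * \<alpha> s * Y s))"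

lemma of_real_Y: "s \<in> {t..t+T} \<Longrightarrow> of_real (Y s) = (\<Sum>k<n. \<zeta> k s)"
  using sum_real by (simp add: Y_def complex_eq_iff)

lemma V_nonneg: "0 \<le> V s"
  by (simp add: V_def sum_nonneg)

lemma V_cont: "continuous_on {t..t+T} V"
  unfolding V_def by (intro continuous_intros \<zeta>_cont) auto

lemma cmod_\<zeta>_le: "k < n \<Longrightarrow> cmod (\<zeta> k s) \<le> sqrt (V s)"
  using member_le_sum[of k "{..<n}" "\<lambda>k. (cmod (\<zeta> k s))\<^sup>2"]
  by (intro real_le_rsqrt) (simp add: V_def)

lemma cmod_sum_\<zeta>_le: "m \<le> n \<Longrightarrow> cmod (\<Sum>k<m. \<zeta> k s) \<le> n * sqrt (V s)"
proof -
  assume m: "m \<le> n"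
  have "cmod (\<Sum>k<m. \<zeta> k s) \<le> (\<Sum>k<m. cmod (\<zeta> k s))" by (rule norm_sum)
  also have "\<dots> \<le> m * sqrt (V s)"
    using sum_bounded_above[of "{..<m}" "\<lambda>k. cmod (\<zeta> k s)" "sqrt (V s)"] cmod_\<zeta>_le m by simp
  also have "\<dots> \<le> n * sqrt (V s)" using m V_nonneg by (intro mult_right_mono) auto
  finally show ?thesis .
qed

lemma Y_square_le: "(Y s)\<^sup>2 \<le> n * V s"
proof -
  have "\<bar>Y s\<bar> \<le> cmod (\<Sum>k<n. \<zeta> k s)" unfolding Y_def by (rule abs_Re_le_cmod)
  also have "\<dots> \<le> (\<Sum>k<n. cmod (\<zeta> k s))" by (rule norm_sum)
  finally have "(Y s)\<^sup>2 \<le> (\<Sum>k<n. cmod (\<zeta> k s))\<^sup>2"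
    by (metis abs_ge_zero power2_abs power_mono)
  also have "\<dots> \<le> n * V s"
    using sum_squared_le_sum_of_squares[of "\<lambda>k. cmod (\<zeta> k s)" "{..<n}"]
    by (simp add: V_def mult.commute)
  finally show ?thesis .
qed

lemma \<zeta>_increment:
  assumes "k < n" "t \<le> r" "r \<le> s" "s \<le> t + T"
  shows "((\<lambda>\<tau>. \<rho> k * \<zeta> k \<tau> + forcing k \<tau>) has_integral (\<zeta> k s - \<zeta> k r)) {r..s}"
proof -
  have *: "((\<lambda>\<tau>. \<rho> k * \<zeta> k \<tau> + forcing k \<tau>) has_integral (\<zeta> k s - \<zeta> k t)) {t..s}" if "s \<in> {t..t+T}" for s
    using \<zeta>_ode[OF assms(1) that]
    by (rule has_integral_eq[rotated]) (use that of_real_Y in \<open>auto simp: forcing_def\<close>)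
  show ?thesis using has_integral_increment[OF *[of r] *[of s]] assms by simp
qed

lemma cmod_forcing_le:
  assumes "k < n" "s \<in> {t..t+T}"
  shows "cmod (forcing k s) \<le> \<epsilon> * (1 + c) * n * sqrt (V s)"
proof -
  have "cmod (of_real (c * \<alpha> s * Y s)) = c * \<alpha> s * \<bar>Y s\<bar>"
    using c \<alpha>_range[OF assms(2)] by (simp only: norm_of_real) (simp add: abs_mult)
  also have "\<dots> \<le> c * 1 * (n * sqrt (V s))"
    using c \<alpha>_range[OF assms(2)] cmod_sum_\<zeta>_le[of n s] abs_Re_le_cmod[of "\<Sum>k<n. \<zeta> k s"]
    by (intro mult_mono) (auto simp: Y_def)
  finally have "cmod ((\<Sum>j<k. \<zeta> j s) - of_real (c * \<alpha> s * Y s)) \<le> n * sqrt (V s) + c * 1 * (n * sqrt (V s))"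
    using norm_triangle_ineq4[of "\<Sum>j<k. \<zeta> j s" "of_real (c * \<alpha> s * Y s)"]
      cmod_sum_\<zeta>_le[of k s] assms(1) by linarith
  then have "\<epsilon> * cmod ((\<Sum>j<k. \<zeta> j s) - of_real (c * \<alpha> s * Y s)) \<le> \<epsilon> * (n * sqrt (V s) + c * 1 * (n * sqrt (V s)))"
    using \<epsilon> by (intro mult_left_mono) auto
  moreover have "cmod (forcing k s) = \<epsilon> * cmod ((\<Sum>j<k. \<zeta> j s) - of_real (c * \<alpha> s * Y s))"
    using \<epsilon> unfolding forcing_def norm_mult by simp
  ultimately show ?thesis by (simp add: algebra_simps)
qed

text \<open>Supplies the bound asked for by \<open>has_integral_norm_square\<close>. It rests on the
  maximum of the continuous \<open>V\<close>, because the quantitative growth estimate itself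
  depends on that chain rule.\<close>

lemma field_bounded:
  assumes "k < n"
  obtains B where "\<And>s. s \<in> {t..t+T} \<Longrightarrow> cmod (\<rho> k * \<zeta> k s + forcing k s) \<le> B"
proof -
  have "\<exists>m\<in>{t..t+T}. \<forall>s\<in>{t..t+T}. V s \<le> V m"
    using T by (intro continuous_attains_sup V_cont) auto
  then obtain S where S: "\<And>s. s \<in> {t..t+T} \<Longrightarrow> V s \<le> S" by blast
  have "cmod (\<rho> k * \<zeta> k s + forcing k s) \<le> cmod (\<rho> k) * sqrt S + \<epsilon> * (1 + c) * n * sqrt S"
    if s: "s \<in> {t..t+T}" for s
  proof -
    have r: "sqrt (V s) \<le> sqrt S" using S[OF s] by simp
    have "cmod (\<rho> k * \<zeta> k s + forcing k s) \<le> cmod (\<rho> k) * cmod (\<zeta> k s) + cmod (forcing k s)"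
      by (metis norm_mult norm_triangle_ineq)
    also have "\<dots> \<le> cmod (\<rho> k) * sqrt S + \<epsilon> * (1 + c) * n * sqrt S"
    proof (intro add_mono mult_left_mono)
      show "cmod (\<zeta> k s) \<le> sqrt S" using cmod_\<zeta>_le[OF assms, of s] r by linarith
      have "\<epsilon> * (1 + c) * n * sqrt (V s) \<le> \<epsilon> * (1 + c) * n * sqrt S"
        using r \<epsilon> c by (intro mult_left_mono) auto
      then show "cmod (forcing k s) \<le> \<epsilon> * (1 + c) * n * sqrt S"
        using cmod_forcing_le[OF assms s] by linarith
    qed simp
    finally show ?thesis .
  qed
  then show ?thesis using that by blast
qed

lemma V_integral:
  assumes "t \<le> r" "r \<le> s" "s \<le> t + T"
  shows "((\<lambda>\<tau>. \<Sum>k<n. 2 * (\<zeta> k \<tau> \<bullet> (\<rho> k * \<zeta> k \<tau> + forcing k \<tau>))) has_integral (V s - V r)) {r..s}"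
proof -
  have "((\<lambda>\<tau>. \<Sum>k<n. 2 * (\<zeta> k \<tau> \<bullet> (\<rho> k * \<zeta> k \<tau> + forcing k \<tau>))) has_integral
      (\<Sum>k<n. (cmod (\<zeta> k s))\<^sup>2 - (cmod (\<zeta> k r))\<^sup>2)) {r..s}"
  proof (rule has_integral_sum)
    fix k assume "k \<in> {..<n}"
    then have k: "k < n" by simp
    obtain B where "\<And>s. s \<in> {t..t+T} \<Longrightarrow> cmod (\<rho> k * \<zeta> k s + forcing k s) \<le> B"
      using field_bounded[OF k] by blast
    then show "((\<lambda>\<tau>. 2 * (\<zeta> k \<tau> \<bullet> (\<rho> k * \<zeta> k \<tau> + forcing k \<tau>))) has_integral
        ((cmod (\<zeta> k s))\<^sup>2 - (cmod (\<zeta> k r))\<^sup>2)) {r..s}"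
      using assms by (intro has_integral_norm_square[where B = B] \<zeta>_increment[OF k]) auto
  qed simp
  then show ?thesis by (simp add: V_def sum_subtractf)
qed

text \<open>The diagonal part is discarded because \<open>Re (\<rho> k) \<le> 0\<close>, and the
  coupling gives \<open>Y\<^sup>2 - V\<close> by \<open>sum_inner_partial_sums\<close>. All modes
  receive the same input, so the feedback terms add up to a multiple of
  \<open>Y\<^sup>2\<close>.\<close>

lemma V_field_le:
  assumes "s \<in> {t..t+T}"
  shows "(\<Sum>k<n. 2 * (\<zeta> k s \<bullet> (\<rho> k * \<zeta> k s + forcing k s))) \<le> \<epsilon> * ((1 - 2 * c * \<alpha> s) * (Y s)\<^sup>2 - V s)"
proof -
  have 1: "\<zeta> k s \<bullet> (\<rho> k * \<zeta> k s) = Re (\<rho> k) * (cmod (\<zeta> k s))\<^sup>2" for k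
    unfolding cmod_power2 by (simp add: inner_complex_def power2_eq_square algebra_simps)
  have 2: "\<zeta> k s \<bullet> forcing k s = \<epsilon> * (\<zeta> k s \<bullet> (\<Sum>j<k. \<zeta> j s)) - \<epsilon> * (c * \<alpha> s * Y s) * Re (\<zeta> k s)" for k
    unfolding forcing_def by (simp add: inner_complex_def algebra_simps)
  have "(\<Sum>k<n. 2 * (\<zeta> k s \<bullet> (\<rho> k * \<zeta> k s + forcing k s))) =
      (\<Sum>k<n. 2 * (Re (\<rho> k) * (cmod (\<zeta> k s))\<^sup>2)) + \<epsilon> * (2 * (\<Sum>k<n. \<zeta> k s \<bullet> (\<Sum>j<k. \<zeta> j s)))
        - 2 * \<epsilon> * (c * \<alpha> s * Y s) * (\<Sum>k<n. Re (\<zeta> k s))"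
    unfolding inner_add_right 1 2 by (simp add: sum.distrib sum_subtractf sum_distrib_left algebra_simps)
  also have "2 * (\<Sum>k<n. \<zeta> k s \<bullet> (\<Sum>j<k. \<zeta> j s)) = (Y s)\<^sup>2 - V s"
    unfolding sum_inner_partial_sums by (simp add: V_def flip: of_real_Y[OF assms])
  also have "(\<Sum>k<n. Re (\<zeta> k s)) = Y s" by (simp add: Y_def)
  also have "(\<Sum>k<n. 2 * (Re (\<rho> k) * (cmod (\<zeta> k s))\<^sup>2)) \<le> 0"
    using re_\<rho> by (intro sum_nonpos) (auto intro: mult_nonpos_nonneg)
  finally show ?thesis by (simp add: algebra_simps power2_eq_square)
qed

text \<open>At a maximum \<open>m\<close> of \<open>V\<close> on the interval,
  \<open>Y\<^sup>2 \<le> n V\<close> gives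
  \<open>V m - V r \<le> \<epsilon> n T V m \<le> V m / 2\<close>. Any starting point in the window
  is allowed, so the estimate also bounds \<open>V\<close> from below by its later values.\<close>

lemma V_growth:
  assumes "t \<le> r" "r \<le> s" "s \<le> t + T"
  shows "V s \<le> 2 * V r"
proof -
  have "continuous_on {r..s} V" using V_cont by (rule continuous_on_subset) (use assms in auto)
  then have "\<exists>m\<in>{r..s}. \<forall>\<tau>\<in>{r..s}. V \<tau> \<le> V m"
    using assms by (intro continuous_attains_sup) auto
  then obtain m where m: "m \<in> {r..s}" "\<And>\<tau>. \<tau> \<in> {r..s} \<Longrightarrow> V \<tau> \<le> V m" by blast
  have "V m - V r \<le> (\<epsilon> * n * V m) * (m - r)"
  proof (rule has_integral_le)
    show "((\<lambda>\<tau>. \<Sum>k<n. 2 * (\<zeta> k \<tau> \<bullet> (\<rho> k * \<zeta> k \<tau> + forcing k \<tau>))) has_integral (V m - V r)) {r..m}"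
      using m(1) assms by (intro V_integral) auto
    show "((\<lambda>_. \<epsilon> * n * V m) has_integral (\<epsilon> * n * V m) * (m - r)) {r..m}"
      using has_integral_const_real[of "\<epsilon> * n * V m" r m] m(1) by (simp add: mult.commute)
    fix \<tau> assume \<tau>: "\<tau> \<in> {r..m}"
    then have \<tau>': "\<tau> \<in> {t..t+T}" using m(1) assms by auto
    have "(1 - 2 * c * \<alpha> \<tau>) * (Y \<tau>)\<^sup>2 \<le> 1 * (Y \<tau>)\<^sup>2"
      using c \<alpha>_range[OF \<tau>'] by (intro mult_right_mono) auto
    also have "\<dots> \<le> n * V m"
      using Y_square_le[of \<tau>] m(2)[of \<tau>] \<tau> m(1) mult_left_mono[of "V \<tau>" "V m" "real n"] by auto
    finally have "(1 - 2 * c * \<alpha> \<tau>) * (Y \<tau>)\<^sup>2 - V \<tau> \<le> n * V m" using V_nonneg[of \<tau>] by linarith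
    then have "\<epsilon> * ((1 - 2 * c * \<alpha> \<tau>) * (Y \<tau>)\<^sup>2 - V \<tau>) \<le> \<epsilon> * (n * V m)"
      using \<epsilon> by (intro mult_left_mono) auto
    then show "(\<Sum>k<n. 2 * (\<zeta> k \<tau> \<bullet> (\<rho> k * \<zeta> k \<tau> + forcing k \<tau>))) \<le> \<epsilon> * n * V m"
      using V_field_le[OF \<tau>'] by (simp add: mult.assoc)
  qed
  also have "\<dots> \<le> (\<epsilon> * n * V m) * T"
    using m(1) assms \<epsilon> V_nonneg by (intro mult_left_mono) auto
  also have "\<dots> = V m * (\<epsilon> * n * T)" by simp
  also have "\<dots> \<le> V m * (1 / 2)" using small V_nonneg by (intro mult_left_mono) auto
  finally have "V m \<le> 2 * V r" by simp
  then show ?thesis using m(2)[of s] assms by auto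
qed

text \<open>
  \<open>free k\<close> is the motion of \<open>\<zeta> k\<close> over the window with the forcing of order \<open>\<epsilon>\<close> dropped.
\<close>
definition free :: "nat \<Rightarrow> real \<Rightarrow> complex" where
  "free k s = exp (\<rho> k * of_real (s - t)) * \<zeta> k t"

definition free_sum :: "real \<Rightarrow> complex" where "free_sum s = (\<Sum>k<n. free k s)"

lemma free_cont: "continuous_on S (free k)"
  unfolding free_def by (intro continuous_intros)

lemma free_sum_cont: "continuous_on S free_sum"
  unfolding free_sum_def by (intro continuous_intros free_cont)

text \<open>The deviation \<open>w\<close> starts at 0 and obeys
  \<open>w' = \<rho> k w + forcing k\<close>. As \<open>Re (\<rho> k) \<le> 0\<close>, only the
  forcing can increase its modulus; comparing squares at the maximum of the modulus and dividing by
  that maximum gives the bound \<open>2 * G * T\<close>.\<close>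

lemma deviation_le:
  assumes k: "k < n" and s: "s \<in> {t..t+T}"
  shows "cmod (\<zeta> k s - free k s) \<le> 4 * \<epsilon> * (1 + c) * n * T * sqrt (V t)"
proof -
  define w where "w s = \<zeta> k s - free k s" for s
  \<comment> \<open>\<open>G\<close> bounds the forcing:
    \<open>V s \<le> 2 * V t \<le> 4 * V t\<close>, so \<open>sqrt (V s)\<close> is at most twice
    \<open>sqrt (V t)\<close>.\<close>
  define G where "G = 2 * \<epsilon> * (1 + c) * n * sqrt (V t)"
  have G0: "0 \<le> G" unfolding G_def using \<epsilon> c V_nonneg by simp
  have g_le: "cmod (forcing k s) \<le> G" if "s \<in> {t..t+T}" for s
  proof -
    have "V s \<le> 2\<^sup>2 * V t" using V_growth[of t s] that V_nonneg[of t] by simp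
    then have "sqrt (V s) \<le> 2 * sqrt (V t)" using real_sqrt_le_mono[of "V s" "2\<^sup>2 * V t"] by (simp add: real_sqrt_mult)
    then have "\<epsilon> * (1 + c) * n * sqrt (V s) \<le> \<epsilon> * (1 + c) * n * (2 * sqrt (V t))"
      using \<epsilon> c by (intro mult_left_mono) auto
    then show ?thesis using cmod_forcing_le[OF k that] by (simp add: G_def)
  qed
  have w_int: "((\<lambda>\<tau>. \<rho> k * w \<tau> + forcing k \<tau>) has_integral (w s - w t)) {t..s}" if "s \<in> {t..t+T}" for s
  proof -
    have "((\<lambda>\<tau>. \<rho> k * free k \<tau>) has_integral (free k s - free k t)) {t..s}"
    proof (rule fundamental_theorem_of_calculus)
      show "t \<le> s" using that by simp
      fix \<tau> assume "\<tau> \<in> {t..s}"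
      have "((\<lambda>z. exp (\<rho> k * (z - of_real t)) * \<zeta> k t) has_field_derivative
          exp (\<rho> k * (of_real \<tau> - of_real t)) * \<rho> k * \<zeta> k t) (at (of_real \<tau>))"
        by (auto intro!: derivative_eq_intros)
      then have "((\<lambda>x. exp (\<rho> k * (of_real x - of_real t)) * \<zeta> k t) has_vector_derivative
          exp (\<rho> k * (of_real \<tau> - of_real t)) * \<rho> k * \<zeta> k t) (at \<tau>)"
        by (rule has_vector_derivative_real_field)
      then have "(free k has_vector_derivative \<rho> k * free k \<tau>) (at \<tau>)"
        by (simp add: free_def[abs_def] mult_ac)
      then show "(free k has_vector_derivative \<rho> k * free k \<tau>) (at \<tau> within {t..s})"
        by (rule has_vector_derivative_at_within)
    qed
    from has_integral_diff[OF \<zeta>_increment[OF k order_refl] this]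
    have "((\<lambda>\<tau>. \<rho> k * \<zeta> k \<tau> + forcing k \<tau> - \<rho> k * free k \<tau>) has_integral
        (\<zeta> k s - \<zeta> k t - (free k s - free k t))) {t..s}" using that by auto
    then show ?thesis by (simp add: w_def algebra_simps)
  qed
  have w_cont: "continuous_on {t..t+T} w"
    unfolding w_def by (intro continuous_intros \<zeta>_cont k free_cont)
  have w_t: "w t = 0" by (simp add: w_def free_def)
  have "\<exists>m\<in>{t..t+T}. \<forall>s\<in>{t..t+T}. cmod (w s) \<le> cmod (w m)"
    using T by (intro continuous_attains_sup continuous_on_norm w_cont) auto
  then obtain m where m: "m \<in> {t..t+T}" "\<And>s. s \<in> {t..t+T} \<Longrightarrow> cmod (w s) \<le> cmod (w m)" by blast
  have "(cmod (w m))\<^sup>2 - (cmod (w t))\<^sup>2 \<le> (2 * cmod (w m) * G) * (m - t)"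
  proof (rule has_integral_le)
    show "((\<lambda>\<tau>. 2 * (w \<tau> \<bullet> (\<rho> k * w \<tau> + forcing k \<tau>))) has_integral ((cmod (w m))\<^sup>2 - (cmod (w t))\<^sup>2)) {t..m}"
    proof (rule has_integral_norm_square)
      fix \<tau> assume "\<tau> \<in> {t..m}"
      then have \<tau>: "\<tau> \<in> {t..t+T}" using m(1) by auto
      show "((\<lambda>\<tau>. \<rho> k * w \<tau> + forcing k \<tau>) has_integral (w \<tau> - w t)) {t..\<tau>}" by (rule w_int[OF \<tau>])
      have "cmod (\<rho> k * w \<tau> + forcing k \<tau>) \<le> cmod (\<rho> k) * cmod (w \<tau>) + cmod (forcing k \<tau>)"
        by (metis norm_mult norm_triangle_ineq)
      also have "\<dots> \<le> cmod (\<rho> k) * cmod (w m) + G"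
        using m(2)[OF \<tau>] g_le[OF \<tau>] by (intro add_mono mult_left_mono) auto
      finally show "cmod (\<rho> k * w \<tau> + forcing k \<tau>) \<le> cmod (\<rho> k) * cmod (w m) + G" .
    qed (use m in auto)
    show "((\<lambda>_. 2 * cmod (w m) * G) has_integral (2 * cmod (w m) * G) * (m - t)) {t..m}"
      using has_integral_const_real[of "2 * cmod (w m) * G" t m] m(1) by (simp add: mult.commute)
    fix \<tau> assume "\<tau> \<in> {t..m}"
    then have \<tau>: "\<tau> \<in> {t..t+T}" using m(1) by auto
    have "w \<tau> \<bullet> (\<rho> k * w \<tau>) = Re (\<rho> k) * (cmod (w \<tau>))\<^sup>2"
      unfolding cmod_power2 by (simp add: inner_complex_def power2_eq_square algebra_simps)
    also have "\<dots> \<le> 0" using re_\<rho>[OF k] by (simp add: mult_nonpos_nonneg)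
    finally have "w \<tau> \<bullet> (\<rho> k * w \<tau> + forcing k \<tau>) \<le> w \<tau> \<bullet> forcing k \<tau>" by (simp add: inner_add_right)
    also have "\<dots> \<le> cmod (w \<tau>) * cmod (forcing k \<tau>)" by (rule norm_cauchy_schwarz)
    also have "\<dots> \<le> cmod (w m) * G" using m(2)[OF \<tau>] g_le[OF \<tau>] by (intro mult_mono) auto
    finally show "2 * (w \<tau> \<bullet> (\<rho> k * w \<tau> + forcing k \<tau>)) \<le> 2 * cmod (w m) * G" by simp
  qed
  also have "\<dots> \<le> (2 * cmod (w m) * G) * T" using m(1) G0 by (intro mult_left_mono) auto
  finally have "cmod (w m) * cmod (w m) \<le> cmod (w m) * (2 * G * T)"
    by (simp add: w_t power2_eq_square mult_ac)
  then have "cmod (w m) \<le> 2 * G * T"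
    using G0 T by (cases "w m = 0") (auto simp: mult_le_cancel_left_pos)
  then have "cmod (w s) \<le> 2 * G * T" using m(2)[OF s] by linarith
  then show ?thesis by (simp add: w_def G_def algebra_simps)
qed

lemma Y_square_near:
  assumes s: "s \<in> {t..t+T}"
  shows "\<bar>(Y s)\<^sup>2 - (cmod (free_sum s))\<^sup>2\<bar> \<le> \<epsilon> * (12 * (1 + c) * n ^ 3 * T) * V t"
proof -
  let ?S = "sqrt (V t)"
  have S0: "0 \<le> ?S" using V_nonneg by simp
  have Y_eq: "\<bar>Y s\<bar> = cmod (\<Sum>k<n. \<zeta> k s)" by (metis norm_of_real of_real_Y[OF s])
  have "V s \<le> 2\<^sup>2 * V t" using V_growth[of t s] s V_nonneg[of t] by simp
  then have "sqrt (V s) \<le> 2 * ?S" using real_sqrt_le_mono[of "V s" "2\<^sup>2 * V t"] by (simp add: real_sqrt_mult)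
  then have "n * sqrt (V s) \<le> n * (2 * ?S)" by (intro mult_left_mono) auto
  then have Y_le: "\<bar>Y s\<bar> \<le> n * (2 * ?S)" using cmod_sum_\<zeta>_le[of n s] Y_eq by linarith
  have f_le: "cmod (free_sum s) \<le> n * ?S"
  proof -
    have "cmod (free_sum s) \<le> (\<Sum>k<n. cmod (free k s))" unfolding free_sum_def by (rule norm_sum)
    also have "\<dots> \<le> (\<Sum>k<n. ?S)"
    proof (rule sum_mono)
      fix k assume k: "k \<in> {..<n}"
      have "cmod (free k s) \<le> 1 * cmod (\<zeta> k t)"
        unfolding free_def norm_mult using re_\<rho>[of k] k s
        by (intro mult_right_mono) (auto simp: mult_nonpos_nonneg)
      also have "\<dots> \<le> ?S" using cmod_\<zeta>_le[of k t] k by simp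
      finally show "cmod (free k s) \<le> ?S" .
    qed
    finally show ?thesis by simp
  qed
  have dev: "\<bar>\<bar>Y s\<bar> - cmod (free_sum s)\<bar> \<le> n * (4 * \<epsilon> * (1 + c) * n * T * ?S)"
  proof -
    have "\<bar>\<bar>Y s\<bar> - cmod (free_sum s)\<bar> \<le> cmod ((\<Sum>k<n. \<zeta> k s) - free_sum s)" unfolding Y_eq by (rule norm_triangle_ineq3)
    also have "\<dots> = cmod (\<Sum>k<n. \<zeta> k s - free k s)" by (simp add: free_sum_def sum_subtractf)
    also have "\<dots> \<le> (\<Sum>k<n. cmod (\<zeta> k s - free k s))" by (rule norm_sum)
    also have "\<dots> \<le> (\<Sum>k<n. 4 * \<epsilon> * (1 + c) * n * T * ?S)"
      using deviation_le[OF _ s] by (intro sum_mono) auto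
    finally show ?thesis by simp
  qed
  have "(Y s)\<^sup>2 - (cmod (free_sum s))\<^sup>2 = (\<bar>Y s\<bar> - cmod (free_sum s)) * (\<bar>Y s\<bar> + cmod (free_sum s))"
    by (simp add: algebra_simps power2_eq_square)
  also have "\<bar>\<dots>\<bar> = \<bar>\<bar>Y s\<bar> - cmod (free_sum s)\<bar> * (\<bar>Y s\<bar> + cmod (free_sum s))" by (simp add: abs_mult)
  \<comment> \<open>The constant 12 arises as 4 from \<open>deviation_le\<close> times 3 from the
    sum of the bounds on \<open>\<bar>Y s\<bar>\<close> and
    \<open>cmod (free_sum s)\<close>.\<close>
  also have "\<dots> \<le> (n * (4 * \<epsilon> * (1 + c) * n * T * ?S)) * (n * (2 * ?S) + n * ?S)"
    using dev Y_le f_le T \<epsilon> c S0 by (intro mult_mono add_mono) auto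
  also have "\<dots> = \<epsilon> * (12 * (1 + c) * n ^ 3 * T) * (?S * ?S)"
    by (simp add: algebra_simps power3_eq_cube)
  also have "?S * ?S = V t" using V_nonneg by simp
  finally show ?thesis .
qed

text \<open>Integrating \<open>V_field_le\<close> with \<open>Y\<close> replaced by
  \<open>free_sum\<close>, the persistence hypothesis makes the main term nonpositive. What is left
  is \<open>\<kappa>\<close>: the replacement error, of order \<open>\<epsilon>\<close>, minus
  \<open>V (t + T) / 2\<close>, a lower bound for \<open>V\<close> on the window by
  \<open>V_growth\<close>. After the outer factor \<open>\<epsilon>\<close> the loss is of order
  \<open>\<epsilon>\<^sup>2\<close> and the gain of order \<open>\<epsilon>\<close>.\<close>

lemma V_contraction:
  assumes pers: "integral {t..t+T} (\<lambda>s. (cmod (free_sum s))\<^sup>2) \<le> 2 * c * integral {t..t+T} (\<lambda>s. \<alpha> s * (cmod (free_sum s))\<^sup>2)"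
  shows "V (t + T) * (1 + \<epsilon> * (T / 2)) \<le> V t * (1 + \<epsilon>\<^sup>2 * ((1 + 2 * c) * (12 * (1 + c) * n ^ 3 * T) * T))"
proof -
  define E where "E = 12 * (1 + c) * n ^ 3 * T"
  let ?F = "\<lambda>s. (cmod (free_sum s))\<^sup>2" and ?I = "integral {t..t+T}"
  define \<kappa> where "\<kappa> = (1 + 2 * c) * (\<epsilon> * E * V t) - V (t + T) / 2"
  have F_int: "?F integrable_on {t..t+T}"
    by (intro integrable_continuous_real continuous_intros free_sum_cont)
  have \<alpha>F_int: "(\<lambda>s. \<alpha> s * ?F s) integrable_on {t..t+T}"
    using \<alpha>_range by (intro integrable_signal_mult \<alpha>_int continuous_intros free_sum_cont) auto
  have "V (t + T) - V t \<le> \<epsilon> * ((?I ?F - 2 * c * ?I (\<lambda>s. \<alpha> s * ?F s)) + \<kappa> * T)"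
  proof (rule has_integral_le)
    show "((\<lambda>\<tau>. \<Sum>k<n. 2 * (\<zeta> k \<tau> \<bullet> (\<rho> k * \<zeta> k \<tau> + forcing k \<tau>))) has_integral (V (t + T) - V t)) {t..t+T}"
      using T by (intro V_integral) auto
    have "((\<lambda>_. \<kappa>) has_integral \<kappa> * T) {t..t+T}"
      using has_integral_const_real[of \<kappa> t "t + T"] T by (simp add: mult.commute)
    then show "((\<lambda>s. \<epsilon> * ((?F s - 2 * c * (\<alpha> s * ?F s)) + \<kappa>)) has_integral
        \<epsilon> * ((?I ?F - 2 * c * ?I (\<lambda>s. \<alpha> s * ?F s)) + \<kappa> * T)) {t..t+T}"
      by (intro has_integral_mult_right has_integral_add has_integral_diff integrable_integral F_int \<alpha>F_int)
    fix s assume s: "s \<in> {t..t+T}"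
    have "(1 - 2 * c * \<alpha> s) * ((Y s)\<^sup>2 - ?F s) \<le> \<bar>1 - 2 * c * \<alpha> s\<bar> * \<bar>(Y s)\<^sup>2 - ?F s\<bar>"
      by (metis abs_ge_self abs_mult)
    also have "\<dots> \<le> (1 + 2 * c) * (\<epsilon> * E * V t)"
    proof (rule mult_mono)
      have "0 \<le> 2 * c * \<alpha> s" "2 * c * \<alpha> s \<le> 2 * c * 1"
        using c \<alpha>_range[OF s] mult_left_mono[of "\<alpha> s" 1 c] by auto
      then show "\<bar>1 - 2 * c * \<alpha> s\<bar> \<le> 1 + 2 * c" by linarith
      show "\<bar>(Y s)\<^sup>2 - ?F s\<bar> \<le> \<epsilon> * E * V t" unfolding E_def by (rule Y_square_near[OF s])
    qed (use c in auto)
    finally have "(1 - 2 * c * \<alpha> s) * ((Y s)\<^sup>2 - ?F s) \<le> (1 + 2 * c) * (\<epsilon> * E * V t)" .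
    moreover have "V (t + T) \<le> 2 * V s" using V_growth[of s "t + T"] s by auto
    ultimately have "(1 - 2 * c * \<alpha> s) * (Y s)\<^sup>2 - V s \<le> (?F s - 2 * c * (\<alpha> s * ?F s)) + \<kappa>"
      by (simp add: \<kappa>_def algebra_simps)
    then have "\<epsilon> * ((1 - 2 * c * \<alpha> s) * (Y s)\<^sup>2 - V s) \<le> \<epsilon> * ((?F s - 2 * c * (\<alpha> s * ?F s)) + \<kappa>)"
      using \<epsilon> by (intro mult_left_mono) auto
    then show "(\<Sum>k<n. 2 * (\<zeta> k s \<bullet> (\<rho> k * \<zeta> k s + forcing k s))) \<le> \<epsilon> * ((?F s - 2 * c * (\<alpha> s * ?F s)) + \<kappa>)"
      using V_field_le[OF s] by linarith
  qed
  also have "\<dots> \<le> \<epsilon> * (\<kappa> * T)" using pers \<epsilon> by (intro mult_left_mono) auto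
  finally show ?thesis by (simp add: \<kappa>_def E_def power2_eq_square algebra_simps)
qed

end

section \<open>Exponential decay of the closed loop\<close>

text \<open>The factor 2 covers growth inside the last, incomplete window. The factor
  \<open>1 / q\<close> covers rounding the number of complete windows down by at most one.\<close>

lemma geometric_windows_imp_exponential:
  fixes W :: "real \<Rightarrow> real"
  assumes "T > 0" "0 < q" "q < 1"
    and nonneg: "\<And>t. t \<ge> t0 \<Longrightarrow> 0 \<le> W t"
    and contr: "\<And>t. t \<ge> t0 \<Longrightarrow> W (t + T) \<le> q * W t"
    and growth: "\<And>t s. t \<ge> t0 \<Longrightarrow> s \<in> {t..t+T} \<Longrightarrow> W s \<le> 2 * W t"
    and t: "t \<ge> t0"
  shows "W t \<le> 2 / q * exp (ln q / T * (t - t0)) * W t0"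
proof -
  define m where "m = nat \<lfloor>(t - t0) / T\<rfloor>"
  have "0 \<le> (t - t0) / T" using t assms(1) by simp
  then have "real m \<le> (t - t0) / T" "(t - t0) / T < real m + 1"
    unfolding m_def by linarith+
  then have m: "m * T \<le> t - t0" "t - t0 \<le> (real m + 1) * T"
    using assms(1) by (simp_all add: field_simps)
  have "W (t0 + real i * T) \<le> q ^ i * W t0" for i
  proof (induction i)
    case (Suc i)
    have "W (t0 + real i * T + T) \<le> q * W (t0 + real i * T)"
      using assms(1) by (intro contr) simp
    also have "\<dots> \<le> q * (q ^ i * W t0)" using Suc assms(2) by (intro mult_left_mono) auto
    finally show ?case by (simp add: algebra_simps)
  qed simp
  then have "W (t0 + real m * T) \<le> q ^ m * W t0" .
  moreover have "W t \<le> 2 * W (t0 + real m * T)"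
    using m assms(1) by (intro growth) (auto simp: algebra_simps)
  ultimately have "W t \<le> 2 * (q ^ m * W t0)" by linarith
  also have "q ^ m = exp (real m * ln q)" using assms(2) by (simp add: exp_of_nat_mult)
  also have "\<dots> \<le> exp (((t - t0) / T - 1) * ln q)"
  proof -
    have "(t - t0) / T - 1 \<le> real m" using m(2) assms(1) by (simp add: field_simps)
    then show ?thesis using assms(2,3) by (simp add: mult_right_mono_neg)
  qed
  also have "\<dots> = 1 / q * exp (ln q / T * (t - t0))"
  proof -
    have "((t - t0) / T - 1) * ln q = ln q / T * (t - t0) - ln q" by (simp add: algebra_simps)
    then show ?thesis using assms(2) by (simp add: exp_diff)
  qed
  finally show ?thesis using nonneg[of t0] by (simp add: mult_right_mono)
qed

lemma quadratic_form_equiv_norm: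
  fixes W :: "'a :: euclidean_space \<Rightarrow> real"
  assumes "continuous_on UNIV W" "\<And>c x. W (c *\<^sub>R x) = c\<^sup>2 * W x" "\<And>x. x \<noteq> 0 \<Longrightarrow> W x > 0"
  shows "\<exists>m>0. \<exists>M>0. \<forall>x. m * (norm x)\<^sup>2 \<le> W x \<and> W x \<le> M * (norm x)\<^sup>2"
proof -
  have S: "compact (sphere (0::'a) 1)" "sphere (0::'a) 1 \<noteq> {}" by auto
  have cont: "continuous_on (sphere 0 1) W" using assms(1) continuous_on_subset by blast
  obtain a where a: "a \<in> sphere 0 1" "\<And>y. y \<in> sphere 0 1 \<Longrightarrow> W a \<le> W y"
    using continuous_attains_inf[OF S cont] by blast
  obtain b where b: "b \<in> sphere 0 1" "\<And>y. y \<in> sphere 0 1 \<Longrightarrow> W y \<le> W b"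
    using continuous_attains_sup[OF S cont] by blast
  have "W a * (norm x)\<^sup>2 \<le> W x \<and> W x \<le> W b * (norm x)\<^sup>2" for x
  proof (cases "x = 0")
    case True
    then show ?thesis using assms(2)[of 0 x] by simp
  next
    case False
    define y where "y = (1 / norm x) *\<^sub>R x"
    have "y \<in> sphere 0 1" "x = norm x *\<^sub>R y" using False by (auto simp: y_def)
    then have "W a \<le> W y" "W y \<le> W b" "W x = (norm x)\<^sup>2 * W y"
      using a b assms(2)[of "norm x" y] by auto
    then show ?thesis by (simp add: mult.commute mult_right_mono)
  qed
  moreover have "W a > 0" "W b > 0" using a(1) b(1) by (auto intro!: assms(3))
  ultimately show ?thesis by blast
qed

section \<open>The feedback vector and the closed loop in cascade coordinates\<close>

lemma linear_real_functional_inner: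
  fixes L :: "'a :: euclidean_space \<Rightarrow> real"
  assumes "linear L"
  shows "\<exists>K. \<forall>x. K \<bullet> x = L x"
  using adjoint_works[OF assms, of _ 1] by (intro exI[of _ "adjoint L 1"]) (simp add: inner_commute)

lemma outer_product_mult_vec: "outer_product b K *v x = (K \<bullet> x) *\<^sub>R b"
  by (simp add: vec_eq_iff matrix_vector_mult_def outer_product_def inner_vec_def sum_distrib_left mult_ac)

lemma PE_signal_window:
  assumes "\<alpha> \<in> PE_signals T \<mu>" "0 \<le> t"
  shows "\<alpha> integrable_on {t..t+T}" "\<mu> \<le> integral {t..t+T} \<alpha>"
proof -
  have \<alpha>: "\<alpha> \<in> borel_measurable (lebesgue_on {0..})" "\<And>s. s \<ge> 0 \<Longrightarrow> 0 \<le> \<alpha> s \<and> \<alpha> s \<le> 1"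
    "\<mu> \<le> (LINT s:{t..t+T}|lebesgue. \<alpha> s)"
    using assms by (auto simp: PE_signals_def)
  have "\<alpha> \<in> borel_measurable (lebesgue_on {t..t+T})"
    using \<alpha>(1) by (rule measurable_restrict_mono) (use assms(2) in auto)
  then have "\<alpha> absolutely_integrable_on {t..t+T}"
    by (rule measurable_bounded_by_integrable_imp_absolutely_integrable[where g = "\<lambda>_. 1"])
      (use \<alpha>(2) assms(2) in auto)
  then show "\<alpha> integrable_on {t..t+T}" "\<mu> \<le> integral {t..t+T} \<alpha>"
    using set_lebesgue_integral_eq_integral[of "{t..t+T}" \<alpha>] \<alpha>(3) by simp_all
qed

lemma PE_signal_shift:
  assumes "\<alpha> \<in> PE_signals T \<mu>" "0 \<le> t"
  shows "\<alpha> \<circ> (+) t \<in> window_signals T \<mu>"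
  using PE_signal_window[OF assms] integrable_on_shift_Icc_real[of \<alpha> t 0 T]
    integral_shift_Icc_real[of 0 T \<alpha> t] assms
  by (auto simp: window_signals_def PE_signals_def add.commute)

text \<open>The functional \<open>\<zeta> k\<close> is applied under the integral; as it maps
  \<open>b\<close> to 1, the feedback enters each mode with the same coefficient. The real part in
  \<open>K\<close> may be dropped because the sum of the modes is real.\<close>

lemma modal_closed_loop_increment:
  fixes A :: "real^'n^'n"
  assumes "modal_coordinates A b \<epsilon> \<rho> \<zeta>" "k < CARD('n)"
    and K: "\<And>x. K \<bullet> x = c * \<epsilon> * Re (\<Sum>j<CARD('n). \<zeta> j x)"
    and sol: "closed_loop_solution A b K \<alpha> t0 x0 x" and "t0 \<le> t" "t \<le> s"
  shows "((\<lambda>r. \<rho> k * \<zeta> k (x r) + of_real \<epsilon> * ((\<Sum>j<k. \<zeta> j (x r)) - of_real (c * \<alpha> r) * (\<Sum>j<CARD('n). \<zeta> j (x r))))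
      has_integral (\<zeta> k (x s) - \<zeta> k (x t))) {t..s}"
proof -
  let ?F = "\<lambda>r. (A - \<alpha> r *\<^sub>R outer_product b K) *v x r"
  have lin: "linear (\<zeta> k)" and \<zeta>b: "\<zeta> k b = 1"
    and \<zeta>A: "\<And>x. \<zeta> k (A *v x) = \<rho> k * \<zeta> k x + of_real \<epsilon> * (\<Sum>j<k. \<zeta> j x)"
    and re: "\<And>x. Im (\<Sum>k<CARD('n). \<zeta> k x) = 0"
    using assms(1,2) by (auto simp: modal_coordinates_def)
  have "(?F has_integral (x t - x0)) {t0..t}" "(?F has_integral (x s - x0)) {t0..s}"
    using sol assms(5,6) by (auto simp: closed_loop_solution_def)
  then have "(?F has_integral ((x s - x0) - (x t - x0))) {t..s}"
    using assms(5,6) by (rule has_integral_increment)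
  then have "(?F has_integral (x s - x t)) {t..s}" by simp
  then have "((\<zeta> k \<circ> ?F) has_integral \<zeta> k (x s - x t)) {t..s}"
    using lin by (intro has_integral_linear) (simp_all add: linear_conv_bounded_linear)
  moreover have "\<zeta> k \<circ> ?F = (\<lambda>r. \<rho> k * \<zeta> k (x r) +
      of_real \<epsilon> * ((\<Sum>j<k. \<zeta> j (x r)) - of_real (c * \<alpha> r) * (\<Sum>j<CARD('n). \<zeta> j (x r))))"
  proof
    fix r
    have "?F r = A *v x r - (\<alpha> r * (K \<bullet> x r)) *\<^sub>R b"
      by (simp add: matrix_vector_mult_diff_rdistrib scaleR_matrix_vector_assoc[symmetric] outer_product_mult_vec)
    then have "(\<zeta> k \<circ> ?F) r = \<zeta> k (A *v x r) - of_real (\<alpha> r * (K \<bullet> x r))"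
      using lin \<zeta>b by (simp add: linear_diff linear_scale of_real_def)
    also have "of_real (\<alpha> r * (K \<bullet> x r)) = of_real \<epsilon> * (of_real (c * \<alpha> r) * of_real (Re (\<Sum>j<CARD('n). \<zeta> j (x r))))"
      unfolding K by (simp add: mult_ac)
    also have "of_real (Re (\<Sum>j<CARD('n). \<zeta> j (x r))) = (\<Sum>j<CARD('n). \<zeta> j (x r))"
      using re[of "x r"] by (intro complex_eqI) (simp_all only: complex.sel Re_complex_of_real Im_complex_of_real)
    finally show "(\<zeta> k \<circ> ?F) r = \<rho> k * \<zeta> k (x r) +
      of_real \<epsilon> * ((\<Sum>j<k. \<zeta> j (x r)) - of_real (c * \<alpha> r) * (\<Sum>j<CARD('n). \<zeta> j (x r)))"
      unfolding \<zeta>A by (simp only: right_diff_distrib add_diff_eq)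
  qed
  ultimately show ?thesis using lin by (simp only: linear_diff)
qed

theorem theorem3p2:
  fixes A :: "real^'n^'n" and b :: "real^'n" and T \<mu> :: real
  assumes "controllable_pair A b"
    and "\<And>z. complex_eigenvalue A z \<Longrightarrow> Re z \<le> 0"
    and "\<mu> > 0" and "T \<ge> \<mu>"
  shows "\<exists>K :: real^'n. stabilizer T \<mu> A b K"
proof -
  let ?n = "CARD('n)"
  have T: "T > 0" using assms by simp
  obtain \<rho> \<epsilon>0 where eig: "\<And>k. k < ?n \<Longrightarrow> complex_eigenvalue A (\<rho> k)" and \<epsilon>0: "\<epsilon>0 > 0"
    and coords: "\<And>\<epsilon>. 0 < \<epsilon> \<Longrightarrow> \<epsilon> < \<epsilon>0 \<Longrightarrow> \<exists>\<zeta>. modal_coordinates A b \<epsilon> \<rho> \<zeta>"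
    using controllable_imp_modal_coordinates[OF assms(1)] by blast
  have re_\<rho>: "\<And>k. k < ?n \<Longrightarrow> Re (\<rho> k) \<le> 0" using eig assms(2) by blast
  obtain \<delta> where \<delta>: "\<delta> > 0" and pers: "\<forall>\<alpha>\<in>window_signals T \<mu>. \<forall>z.
      \<delta> * integral {0..T} (\<lambda>s. (cmod (\<Sum>k<?n. z k * exp (\<rho> k * of_real s)))\<^sup>2) \<le>
      integral {0..T} (\<lambda>s. \<alpha> s * (cmod (\<Sum>k<?n. z k * exp (\<rho> k * of_real s)))\<^sup>2)"
    using exp_sum_persistence[of ?n \<rho> T \<mu>] re_\<rho> T assms(3) by blast
  \<comment> \<open>This gain makes \<open>2 * c * \<delta> = 1\<close>, so that the weighted
    integral times \<open>2 * c\<close> dominates the plain one. It is fixed before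
    \<open>\<epsilon>\<close>.\<close>
  define c where "c = 1 / (2 * \<delta>)"
  have c: "c > 0" using \<delta> by (simp add: c_def)
  define D where "D = (1 + 2 * c) * (12 * (1 + c) * real ?n ^ 3 * T) * T"
  have D: "D \<ge> 0" using c T by (simp add: D_def)
  \<comment> \<open>The three bounds ensure that coordinates exist, that \<open>V\<close> at most
    doubles on a window, and that \<open>\<epsilon> * D < T / 2\<close>, where \<open>D\<close> is
    the loss constant of \<open>V_contraction\<close>.\<close>
  define \<epsilon> where "\<epsilon> = min (\<epsilon>0 / 2) (min (1 / (2 * ?n * T)) (T / (4 * (D + 1))))"
  have \<epsilon>: "\<epsilon> > 0" "\<epsilon> < \<epsilon>0"
    using \<epsilon>0 T D by (auto simp: \<epsilon>_def min_less_iff_disj)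
  have "\<epsilon> \<le> 1 / (2 * ?n * T)" by (simp add: \<epsilon>_def)
  then have small: "\<epsilon> * ?n * T \<le> 1 / 2" using T by (simp add: field_simps)
  have "\<epsilon> \<le> T / (4 * (D + 1))" by (simp add: \<epsilon>_def)
  then have "\<epsilon> * (D + 1) \<le> T / 4" using D by (simp add: field_simps)
  then have \<epsilon>D: "\<epsilon> * D < T / 2" using \<epsilon>(1) T by (simp add: algebra_simps)
  \<comment> \<open>The contraction factor that \<open>V_contraction\<close> yields; it is below 1
    exactly when \<open>\<epsilon> * D < T / 2\<close>.\<close>
  define q where "q = (1 + \<epsilon>\<^sup>2 * D) / (1 + \<epsilon> * (T / 2))"
  have den: "1 + \<epsilon> * (T / 2) > 0" using \<epsilon>(1) T by (simp add: add_pos_pos)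
  have "1 + \<epsilon>\<^sup>2 * D > 0" using D by (simp add: add_pos_nonneg)
  then have q0: "q > 0" using den by (simp add: q_def)
  have "\<epsilon> * (\<epsilon> * D) < \<epsilon> * (T / 2)" using \<epsilon>D \<epsilon>(1) by (rule mult_strict_left_mono)
  then have q1: "q < 1" using den by (simp add: q_def power2_eq_square)
  obtain \<zeta> where \<zeta>: "modal_coordinates A b \<epsilon> \<rho> \<zeta>" using coords[OF \<epsilon>] by blast
  have lin: "linear (\<zeta> k)" if "k < ?n" for k
    using \<zeta> that by (simp add: modal_coordinates_def)
  define W where "W x = (\<Sum>k<?n. (cmod (\<zeta> k x))\<^sup>2)" for x
  have \<zeta>_cont: "continuous_on S (\<zeta> k)" if "k < ?n" for S k
    using lin[OF that] by (simp add: linear_continuous_on linear_conv_bounded_linear)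
  have W_nonneg: "0 \<le> W x" for x by (simp add: W_def sum_nonneg)
  have "continuous_on UNIV W" unfolding W_def by (intro continuous_intros \<zeta>_cont) auto
  moreover have "W (a *\<^sub>R x) = a\<^sup>2 * W x" for a x
    using lin by (simp add: W_def linear_scale power_mult_distrib sum_distrib_left)
  moreover have "W x > 0" if "x \<noteq> 0" for x
  proof (rule ccontr)
    assume "\<not> W x > 0"
    then have "W x = 0" using W_nonneg[of x] by simp
    then have "\<forall>k<?n. \<zeta> k x = 0" by (simp add: W_def sum_nonneg_eq_0_iff)
    then show False using \<zeta> that by (simp add: modal_coordinates_def)
  qed
  ultimately have "\<exists>m>0. \<exists>M>0. \<forall>x. m * (norm x)\<^sup>2 \<le> W x \<and> W x \<le> M * (norm x)\<^sup>2"
    by (rule quadratic_form_equiv_norm)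
  then obtain m M where mM: "m > 0" "M > 0" "\<And>x. m * (norm x)\<^sup>2 \<le> W x" "\<And>x. W x \<le> M * (norm x)\<^sup>2"
    by blast
  have L: "linear (\<lambda>x. c * \<epsilon> * Re (\<Sum>j<?n. \<zeta> j x))"
    using lin by (intro linearI)
      (simp_all add: linear_add linear_scale sum.distrib algebra_simps sum_distrib_left)
  \<comment> \<open>Since the closed loop subtracts \<open>\<alpha> b K^T\<close>, this
    \<open>K\<close> realises the input \<open>u = - c \<epsilon> Y\<close>.\<close>
  obtain K where "\<forall>x. K \<bullet> x = c * \<epsilon> * Re (\<Sum>j<?n. \<zeta> j x)"
    using linear_real_functional_inner[OF L] ..
  then have K: "K \<bullet> x = c * \<epsilon> * Re (\<Sum>j<?n. \<zeta> j x)" for x ..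
  \<comment> \<open>\<open>W\<close> decays at rate \<open>ln q / T\<close> and is comparable to the
    squared norm, so the norm inherits half the rate and the square root of the constant.\<close>
  define C where "C = sqrt (2 * M / (q * m))"
  define \<gamma> where "\<gamma> = - ln q / T / 2"
  have C: "C > 0" and \<gamma>: "\<gamma> > 0" using mM(1,2) q0 q1 T by (simp_all add: C_def \<gamma>_def divide_neg_pos)
  have decay: "norm (x t) \<le> C * exp (- \<gamma> * (t - t0)) * norm x0"
    if \<alpha>: "\<alpha> \<in> PE_signals T \<mu>" and t0: "t0 \<ge> 0" and sol: "closed_loop_solution A b K \<alpha> t0 x0 x"
      and t: "t \<ge> t0" for \<alpha> t0 x0 x t
  proof -
    have x_cont: "continuous_on {t0..} x" and x_t0: "x t0 = x0"
      using sol by (auto simp: closed_loop_solution_def)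
    have window: "modal_window ?n \<rho> \<epsilon> c t T \<alpha> (\<lambda>k s. \<zeta> k (x s))" if t: "t \<ge> t0" for t
    proof
      show "\<alpha> integrable_on {t..t+T}"
        by (rule PE_signal_window(1)[OF \<alpha>]) (use t t0 in simp)
      show "0 \<le> \<alpha> s \<and> \<alpha> s \<le> 1" if "s \<in> {t..t+T}" for s
        using \<alpha> that t t0 by (auto simp: PE_signals_def)
      show "continuous_on {t..t+T} (\<lambda>s. \<zeta> k (x s))" if "k < ?n" for k
        by (rule continuous_on_compose2[OF \<zeta>_cont[OF that, of UNIV] continuous_on_subset[OF x_cont]])
          (use t in auto)
      show "Im (\<Sum>k<?n. \<zeta> k (x s)) = 0" for s using \<zeta> by (simp add: modal_coordinates_def)
      show "((\<lambda>r. \<rho> k * \<zeta> k (x r) + of_real \<epsilon> * ((\<Sum>j<k. \<zeta> j (x r)) - of_real (c * \<alpha> r) * (\<Sum>j<?n. \<zeta> j (x r))))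
        has_integral (\<zeta> k (x s) - \<zeta> k (x t))) {t..s}" if "k < ?n" "s \<in> {t..t+T}" for k s
        using modal_closed_loop_increment[OF \<zeta> that(1) K sol t] that(2) by simp
    qed (use T \<epsilon>(1) c small re_\<rho> in auto)
    have V_eq: "modal_window.V ?n (\<lambda>k s. \<zeta> k (x s)) s = W (x s)" if "t \<ge> t0" for s t
      using modal_window.V_def[OF window[OF that]] by (simp add: W_def)
    have growth: "W (x s) \<le> 2 * W (x t)" if "t \<ge> t0" "s \<in> {t..t+T}" for s t
      using modal_window.V_growth[OF window[OF that(1)], of t s] that by (simp add: V_eq[OF that(1)])
    have contr: "W (x (t + T)) \<le> q * W (x t)" if t: "t \<ge> t0" for t
    proof -
      interpret modal_window ?n \<rho> \<epsilon> c t T \<alpha> "\<lambda>k s. \<zeta> k (x s)" by (rule window[OF t])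
      \<comment> \<open>Moved to start at 0, the free motion is an exponential sum with coefficients
        \<open>\<zeta> k (x t)\<close>. Since \<open>pers\<close> holds for all coefficients and
        signals, one \<open>\<delta>\<close> serves every window.\<close>
      let ?h = "\<lambda>s. (cmod (\<Sum>k<?n. \<zeta> k (x t) * exp (\<rho> k * of_real s)))\<^sup>2"
      have sum_eq: "(\<Sum>k<?n. \<zeta> k (x t) * exp (\<rho> k * of_real s)) = free_sum (t + s)" for s
        by (simp add: free_sum_def free_def mult.commute)
      have h: "?h = (\<lambda>s. (cmod (free_sum s))\<^sup>2) \<circ> (+) t"
        unfolding sum_eq by (simp add: fun_eq_iff)
      have "(\<lambda>s. (\<alpha> \<circ> (+) t) s * ?h s) = (\<lambda>s. \<alpha> s * (cmod (free_sum s))\<^sup>2) \<circ> (+) t"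
        unfolding sum_eq by (simp add: fun_eq_iff)
      moreover have "\<delta> * integral {0..T} ?h \<le> integral {0..T} (\<lambda>s. (\<alpha> \<circ> (+) t) s * ?h s)"
        using t t0 by (intro bspec[OF pers, THEN spec] PE_signal_shift[OF \<alpha>]) simp
      ultimately have "\<delta> * integral {t..t+T} (\<lambda>s. (cmod (free_sum s))\<^sup>2) \<le>
          integral {t..t+T} (\<lambda>s. \<alpha> s * (cmod (free_sum s))\<^sup>2)"
        using h by (simp only: integral_shift_Icc_real) (simp add: add.commute)
      then have "integral {t..t+T} (\<lambda>s. (cmod (free_sum s))\<^sup>2) \<le>
          2 * c * integral {t..t+T} (\<lambda>s. \<alpha> s * (cmod (free_sum s))\<^sup>2)"
        using \<delta> by (simp add: c_def field_simps)
      from V_contraction[OF this] have "W (x (t + T)) * (1 + \<epsilon> * (T / 2)) \<le> W (x t) * (1 + \<epsilon>\<^sup>2 * D)"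
        by (simp add: V_eq[OF t] D_def)
      then show ?thesis using den by (simp add: q_def field_simps)
    qed
    have "W (x t) \<le> 2 / q * exp (ln q / T * (t - t0)) * W (x t0)"
      by (rule geometric_windows_imp_exponential[where W = "\<lambda>t. W (x t)", OF T q0 q1 W_nonneg contr growth t])
    also have "\<dots> \<le> 2 / q * exp (ln q / T * (t - t0)) * (M * (norm x0)\<^sup>2)"
      using mM(4)[of "x t0"] q0 x_t0 by (intro mult_left_mono) auto
    finally have "m * (norm (x t))\<^sup>2 \<le> 2 / q * exp (ln q / T * (t - t0)) * (M * (norm x0)\<^sup>2)"
      using mM(3)[of "x t"] by linarith
    then have "(norm (x t))\<^sup>2 \<le> 2 * M / (q * m) * exp (ln q / T * (t - t0)) * (norm x0)\<^sup>2"
      using mM(1) q0 by (simp add: field_simps)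
    also have "exp (ln q / T * (t - t0)) = (exp (- \<gamma> * (t - t0)))\<^sup>2"
      by (simp add: \<gamma>_def flip: exp_double)
    also have "2 * M / (q * m) = C\<^sup>2" using mM(1,2) q0 by (simp add: C_def)
    finally have "(norm (x t))\<^sup>2 \<le> (C * exp (- \<gamma> * (t - t0)) * norm x0)\<^sup>2"
      by (simp only: power_mult_distrib)
    then show ?thesis by (rule power2_le_imp_le) (use \<open>C > 0\<close> in simp)
  qed
  have "stabilizer T \<mu> A b K"
    unfolding stabilizer_def by (intro exI[of _ C] exI[of _ \<gamma>] conjI ballI allI impI C \<gamma> decay)
  then show ?thesis ..
qed

end
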